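(* Let $\mathcal{H}$ be a complex infinite-dimensional Hilbert space, let $n>1$ be an integer, and let $A\in B(\mathcal{H})$ be such that $A^n$ is a normal operator. If $A$ is dominant, or if $A$ is of class $\mathcal{A}(1,1)$, then $A$ is normal.
   Context: $S\in B(\mathcal{H})$ is dominant if for every $\lambda\in\mathbb{C}$ there is a real $M_\lambda>0$ with $\|(S-\lambda)^*x\|\le M_\lambda\|(S-\lambda)x\|$ for all $x\in\mathcal{H}$. $S$ is of class $\mathcal{A}(1,1)$ if $|S|^2\le|S^2|$, where $|T|=(T^*T)^{1/2}$. *)

theory Defs
  imports "HOL-Analysis.Analysis"
begin

class complex_hilbert = banach +
  fixes scaleC :: "complex \<Rightarrow> 'a \<Rightarrow> 'a"
    and cinner :: "'a \<Rightarrow> 'a \<Rightarrow> complex"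
  assumes scaleC_add_right: "scaleC a (x + y) = scaleC a x + scaleC a y"
    and scaleC_add_left: "scaleC (a + b) x = scaleC a x + scaleC b x"
    and scaleC_scaleC: "scaleC a (scaleC b x) = scaleC (a * b) x"
    and scaleC_one: "scaleC 1 x = x"
    and scaleC_of_real: "scaleC (complex_of_real r) x = scaleR r x"
    and cinner_commute: "cinner x y = cnj (cinner y x)"
    and cinner_add_left: "cinner (x + y) z = cinner x z + cinner y z"
    and cinner_scaleC_left: "cinner (scaleC a x) y = a * cinner x y"
    and cinner_self_norm: "cinner x x = complex_of_real ((norm x)\<^sup>2)"

definition infinite_dim :: "'a::complex_hilbert itself \<Rightarrow> bool" where
  "infinite_dim _ \<longleftrightarrow>
     \<not> (\<exists>B::'a set. finite B \<and> (\<forall>x. \<exists>c. x = (\<Sum>b\<in>B. scaleC (c b) b)))"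

definition bounded_op :: "('a::complex_hilbert \<Rightarrow> 'a) \<Rightarrow> bool" where
  "bounded_op T \<longleftrightarrow>
     (\<forall>x y. T (x + y) = T x + T y) \<and> (\<forall>c x. T (scaleC c x) = scaleC c (T x)) \<and>
     (\<exists>K. \<forall>x. norm (T x) \<le> K * norm x)"

definition adj :: "('a::complex_hilbert \<Rightarrow> 'a) \<Rightarrow> ('a \<Rightarrow> 'a)" where
  "adj T = (THE S. \<forall>x y. cinner (T x) y = cinner x (S y))"

definition normal_op :: "('a::complex_hilbert \<Rightarrow> 'a) \<Rightarrow> bool" where
  "normal_op T \<longleftrightarrow> T \<circ> adj T = adj T \<circ> T"

definition shift_op :: "('a::complex_hilbert \<Rightarrow> 'a) \<Rightarrow> complex \<Rightarrow> ('a \<Rightarrow> 'a)" where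
  "shift_op S l = (\<lambda>x. S x - scaleC l x)"

definition dominant :: "('a::complex_hilbert \<Rightarrow> 'a) \<Rightarrow> bool" where
  "dominant S \<longleftrightarrow> (\<forall>l. \<exists>M::real. M > 0 \<and>
     (\<forall>x. norm (adj (shift_op S l) x) \<le> M * norm (shift_op S l x)))"

definition positive_op :: "('a::complex_hilbert \<Rightarrow> 'a) \<Rightarrow> bool" where
  "positive_op T \<longleftrightarrow> (\<forall>x. Im (cinner (T x) x) = 0 \<and> Re (cinner (T x) x) \<ge> 0)"

definition op_le :: "('a::complex_hilbert \<Rightarrow> 'a) \<Rightarrow> ('a \<Rightarrow> 'a) \<Rightarrow> bool" where
  "op_le T S \<longleftrightarrow> positive_op (\<lambda>x. S x - T x)"

definition op_sqrt :: "('a::complex_hilbert \<Rightarrow> 'a) \<Rightarrow> ('a \<Rightarrow> 'a)" where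
  "op_sqrt P = (THE R. bounded_op R \<and> positive_op R \<and> R \<circ> R = P)"

definition op_abs :: "('a::complex_hilbert \<Rightarrow> 'a) \<Rightarrow> ('a \<Rightarrow> 'a)" where
  "op_abs T = op_sqrt (adj T \<circ> T)"

definition class_A11 :: "('a::complex_hilbert \<Rightarrow> 'a) \<Rightarrow> bool" where
  "class_A11 S \<longleftrightarrow> op_le (op_abs S \<circ> op_abs S) (op_abs (S \<circ> S))"

end

(*
The form q x = |A x|^2 - |A* x|^2 is additive over orthogonal subspaces reducing A, so it suffices to
bound it by \<delta> |x|^2 on the ranges of spectral projections of N = A^n on which N is close, in operator
norm, to a scalar \<nu>; bisection then gives the bound everywhere, so q = 0.

No spectral theorem is needed. The projection for |N - l|^2 \<le> c is the one onto the kernel of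
|C| - C, where C = c - (N - l)* (N - l). Its range consists of vectors on which the powers of N - l grow
at most like c^(k/2), a property inherited by images under operators commuting with N; applied to A and
A* this replaces Fuglede's theorem.

On a piece with N close to \<nu>: if A is paranormal (which class A(1,1) implies), then
|A x|^n \<le> |A^n x| |x|^(n-1) shows that A is close to a multiple of an isometry, and so is A*. If A is
dominant and \<nu> \<noteq> 0, each x is a sum of n approximate eigenvectors of A, at the n-th roots of \<nu>, and
dominance at these finitely many points makes A* A - A A* small on each; if \<nu> = 0, dominance at 0
makes A itself small.
*)

theory Submission
  imports Defs
begin

section \<open>Inner product and bounded operators\<close>

text \<open>The obstacle is that \<open>adj A\<close> need not visibly commute with
  \<open>N = A ^^ n\<close>: only \<open>A\<close> does, while \<open>adj A\<close> commutes with
  \<open>adj N\<close>. Hence the projections are required to commute with every bounded operator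
  that commutes with \<open>N\<close>; being self-adjoint, they then commute with
  \<open>adj A\<close> too. Bisection works on real intervals, so it is run three times, for the
  shifts of \<open>N\<close> by 0, 1 and \<i>. It needs a radius \<open>h\<close> that may depend on
  \<nu> and \<delta> but not on the projection, and the local estimates are stated in that uniform
  form. One inequality, |T w|^2 \<le> m |T (T w)| |w|, carries three arguments: for normal operators
  (m = 1) it yields invariance of spectral subspaces, for paranormal ones (m = 1) the upper bound on
  \<open>A\<close>, for dominant ones (m the constant at 0) the case \<nu> = 0. That q vanishes on
  all vectors is enough, because over the complex numbers polarisation recovers an operator from its
  quadratic form.\<close>

lemma scaleR_scaleC: "scaleR r (x::'a::complex_hilbert) = scaleC (complex_of_real r) x"
  by (simp add: scaleC_of_real)

lemma scaleC_commute: "scaleC a (scaleC b (x::'a::complex_hilbert)) = scaleC b (scaleC a x)"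
  by (simp add: scaleC_scaleC mult.commute)

lemma scaleC_scaleR: "scaleC a (scaleR r (x::'a::complex_hilbert)) = scaleR r (scaleC a x)"
  by (simp add: scaleR_scaleC scaleC_commute)

lemma cinner_add_right: "cinner x (y + z) = cinner x y + cinner x (z::'a::complex_hilbert)"
  by (metis cinner_commute cinner_add_left complex_cnj_add)

lemma cinner_scaleC_right: "cinner x (scaleC a y) = cnj a * cinner x (y::'a::complex_hilbert)"
  by (metis cinner_commute cinner_scaleC_left complex_cnj_mult)

lemma cinner_scaleR_left: "cinner (scaleR r x) y = r * cinner x (y::'a::complex_hilbert)"
  by (simp add: scaleR_scaleC cinner_scaleC_left)

lemma cinner_scaleR_right: "cinner x (scaleR r y) = r * cinner x (y::'a::complex_hilbert)"
  by (simp add: scaleR_scaleC cinner_scaleC_right)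

lemma additive_cinner_left: "Modules.additive (\<lambda>x. cinner x (y::'a::complex_hilbert))"
  by (simp add: Modules.additive_def cinner_add_left)

lemma additive_cinner_right: "Modules.additive (cinner (x::'a::complex_hilbert))"
  by (simp add: Modules.additive_def cinner_add_right)

lemmas cinner_zero_left [simp] = Modules.additive.zero [OF additive_cinner_left]
lemmas cinner_zero_right [simp] = Modules.additive.zero [OF additive_cinner_right]
lemmas cinner_diff_left = Modules.additive.diff [OF additive_cinner_left]
lemmas cinner_diff_right = Modules.additive.diff [OF additive_cinner_right]

lemma Re_cinner_self: "Re (cinner x x) = (norm (x::'a::complex_hilbert))\<^sup>2"
  by (simp add: cinner_self_norm)

lemma Re_cinner_commute: "Re (cinner x y) = Re (cinner y (x::'a::complex_hilbert))"
  by (subst cinner_commute) simp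

lemma norm_add_sq:
  "(norm (x + y))\<^sup>2 = (norm x)\<^sup>2 + 2 * Re (cinner x y) + (norm (y::'a::complex_hilbert))\<^sup>2"
  unfolding Re_cinner_self [symmetric]
  by (simp add: cinner_add_left cinner_add_right Re_cinner_commute [of y x])

lemma norm_diff_sq:
  "(norm (x - y))\<^sup>2 = (norm x)\<^sup>2 - 2 * Re (cinner x y) + (norm (y::'a::complex_hilbert))\<^sup>2"
  unfolding Re_cinner_self [symmetric]
  by (simp add: cinner_diff_left cinner_diff_right Re_cinner_commute [of y x])

text \<open>The class provides homogeneity of the norm for real scalars only; the complex case comes
  from \<open>cinner_self_norm\<close>.\<close>

lemma norm_scaleC: "norm (scaleC a (x::'a::complex_hilbert)) = cmod a * norm x"
proof -
  have "complex_of_real ((norm (scaleC a x))\<^sup>2) = a * (cnj a * cinner x x)"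
    by (metis cinner_self_norm cinner_scaleC_left cinner_scaleC_right)
  also have "\<dots> = complex_of_real ((cmod a * norm x)\<^sup>2)"
    by (simp add: cinner_self_norm power_mult_distrib complex_norm_square mult.assoc
        flip: of_real_power)
  finally show ?thesis
    by (simp only: of_real_eq_iff) (simp add: power2_eq_iff_nonneg)
qed

lemma Cauchy_Schwarz_cinner: "cmod (cinner x y) \<le> norm x * norm (y::'a::complex_hilbert)"
proof (cases "y = 0")
  case False
  define a where "a = cinner x y / complex_of_real ((norm y)\<^sup>2)"
  have "0 \<le> (norm (x - scaleC a y))\<^sup>2" by simp
  also have "\<dots> = (norm x)\<^sup>2 - 2 * Re (cnj a * cinner x y) + (cmod a * norm y)\<^sup>2"
    by (simp add: norm_diff_sq cinner_scaleC_right norm_scaleC)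
  also have "cnj a * cinner x y = complex_of_real ((cmod (cinner x y))\<^sup>2 / (norm y)\<^sup>2)"
    by (simp only: of_real_divide complex_norm_square a_def) (simp add: mult.commute)
  also have "(cmod a * norm y)\<^sup>2 = (cmod (cinner x y))\<^sup>2 / (norm y)\<^sup>2"
    using False by (simp add: a_def norm_divide norm_power power_divide power_mult_distrib
        del: of_real_power) (simp add: field_simps power2_eq_square power4_eq_xxxx)
  finally have "(cmod (cinner x y))\<^sup>2 / (norm y)\<^sup>2 \<le> (norm x)\<^sup>2"
    by simp
  then have "(cmod (cinner x y))\<^sup>2 \<le> (norm x * norm y)\<^sup>2"
    using False by (simp add: field_simps power_mult_distrib)
  then show ?thesis
    by (rule power2_le_imp_le) simp
qed simp

lemma Re_cinner_le: "Re (cinner x y) \<le> norm x * norm (y::'a::complex_hilbert)"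
  using Cauchy_Schwarz_cinner [of x y] complex_Re_le_cmod [of "cinner x y"] by linarith

lemma bounded_bilinear_cinner: "bounded_bilinear (cinner :: 'a::complex_hilbert \<Rightarrow> _)"
proof
  show "\<exists>K. \<forall>a b::'a. norm (cinner a b) \<le> norm a * norm b * K"
    by (rule exI [of _ 1]) (simp add: Cauchy_Schwarz_cinner)
qed (simp_all add: cinner_add_left cinner_add_right cinner_scaleR_left cinner_scaleR_right
      scaleR_conv_of_real)

lemmas tendsto_cinner = bounded_bilinear.tendsto [OF bounded_bilinear_cinner]

lemma bounded_linear_scaleC: "bounded_linear (scaleC a :: 'a::complex_hilbert \<Rightarrow> 'a)"
  by (rule bounded_linear_intro [where K = "cmod a"])
    (simp_all add: scaleC_add_right scaleC_scaleR norm_scaleC mult.commute)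

lemma additive_scaleC_left: "Modules.additive (\<lambda>a. scaleC a (x::'a::complex_hilbert))"
  by (simp add: Modules.additive_def scaleC_add_left)

lemmas scaleC_zero_right [simp] = linear_0 [OF bounded_linear.linear, OF bounded_linear_scaleC]
lemmas scaleC_diff_right = linear_diff [OF bounded_linear.linear, OF bounded_linear_scaleC]
lemmas scaleC_sum_right = linear_sum [OF bounded_linear.linear, OF bounded_linear_scaleC]
lemmas tendsto_scaleC = bounded_linear.tendsto [OF bounded_linear_scaleC]
lemmas scaleC_zero_left [simp] = Modules.additive.zero [OF additive_scaleC_left]
lemmas scaleC_sum_left = Modules.additive.sum [OF additive_scaleC_left]

lemma cinner_ext_right: "(\<And>z::'a::complex_hilbert. cinner z x = cinner z y) \<Longrightarrow> x = y"
proof -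
  assume a: "\<And>z. cinner z x = cinner z y"
  have "cinner (x - y) (x - y) = 0"
    by (simp add: cinner_diff_right a)
  then show "x = y"
    by (simp add: cinner_self_norm)
qed

lemma cinner_ext_left: "(\<And>z::'a::complex_hilbert. cinner x z = cinner y z) \<Longrightarrow> x = y"
  by (rule cinner_ext_right) (metis cinner_commute)

section \<open>Bounded operators\<close>

lemma bounded_op_add: "bounded_op T \<Longrightarrow> T (x + y) = T x + T y"
  and bounded_op_scaleC: "bounded_op T \<Longrightarrow> T (scaleC c x) = scaleC c (T x)"
  by (simp_all add: bounded_op_def)

lemma bounded_op_scaleR: "bounded_op T \<Longrightarrow> T (scaleR r x) = scaleR r (T x)"
  unfolding scaleR_scaleC by (rule bounded_op_scaleC)

lemma bounded_op_bound:
  assumes "bounded_op T"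
  shows "\<exists>K>0. \<forall>x. norm (T x) \<le> K * norm x"
proof -
  obtain K where K: "\<And>x. norm (T x) \<le> K * norm x"
    using assms by (auto simp: bounded_op_def)
  have "norm (T x) \<le> max K 1 * norm x" for x
    by (rule order_trans [OF K mult_right_mono]) auto
  then show ?thesis
    by (intro exI [of _ "max K 1"]) auto
qed

lemma bounded_opI:
  assumes "\<And>x y. T (x + y) = T x + T y" "\<And>c x. T (scaleC c x) = scaleC c (T x)"
    and "\<And>x. norm (T x) \<le> K * norm x"
  shows "bounded_op T"
  using assms by (auto simp: bounded_op_def)

lemma bounded_op_imp_bounded_linear:
  assumes T: "bounded_op T"
  shows "bounded_linear T"
proof -
  obtain K where "\<And>x. norm (T x) \<le> K * norm x"
    using bounded_op_bound [OF T] by blast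
  then show ?thesis
    using T by (intro bounded_linear_intro [where K = K])
      (auto simp: bounded_op_add [OF T] bounded_op_scaleR [OF T] mult.commute)
qed

lemmas bounded_op_diff = linear_diff [OF bounded_linear.linear, OF bounded_op_imp_bounded_linear]
lemmas bounded_op_zero = linear_0 [OF bounded_linear.linear, OF bounded_op_imp_bounded_linear]
lemmas bounded_op_sum = linear_sum [OF bounded_linear.linear, OF bounded_op_imp_bounded_linear]
lemmas bounded_op_tendsto = bounded_linear.tendsto [OF bounded_op_imp_bounded_linear]

lemma bounded_op_id: "bounded_op (\<lambda>x. x)"
  by (rule bounded_opI [where K = 1]) auto

lemma bounded_op_zero_op: "bounded_op (\<lambda>x. 0)"
  by (rule bounded_opI [where K = 0]) auto

lemma bounded_op_scaleC_op:
  assumes T: "bounded_op T"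
  shows "bounded_op (\<lambda>x. scaleC c (T x))"
proof -
  obtain K where "\<And>x. norm (T x) \<le> K * norm x"
    using bounded_op_bound [OF T] by blast
  then show ?thesis
    by (intro bounded_opI [where K = "cmod c * K"])
      (auto simp: bounded_op_add [OF T] bounded_op_scaleC [OF T] scaleC_add_right
        scaleC_commute [of c] norm_scaleC mult.assoc intro!: mult_left_mono)
qed

lemma bounded_op_scaleR_op: "bounded_op T \<Longrightarrow> bounded_op (\<lambda>x. scaleR r (T x))"
  by (simp add: scaleR_scaleC bounded_op_scaleC_op)

lemma bounded_op_compose:
  assumes "bounded_op S" "bounded_op T"
  shows "bounded_op (\<lambda>x. S (T x))"
proof -
  obtain K where K: "K > 0" "\<And>x. norm (S x) \<le> K * norm x"
    using bounded_op_bound [OF assms(1)] by blast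
  obtain L where L: "\<And>x. norm (T x) \<le> L * norm x"
    using bounded_op_bound [OF assms(2)] by blast
  have "norm (S (T x)) \<le> K * L * norm x" for x
  proof -
    have "norm (S (T x)) \<le> K * norm (T x)" by (rule K)
    also have "\<dots> \<le> K * (L * norm x)" using K(1) L by (intro mult_left_mono) auto
    finally show ?thesis by (simp add: mult.assoc)
  qed
  then show ?thesis
    using assms by (intro bounded_opI) (auto simp: bounded_op_def)
qed

lemma bounded_op_add_op:
  assumes "bounded_op S" "bounded_op T"
  shows "bounded_op (\<lambda>x. S x + T x)"
proof -
  obtain K where K: "\<And>x. norm (S x) \<le> K * norm x"
    using bounded_op_bound [OF assms(1)] by blast
  obtain L where L: "\<And>x. norm (T x) \<le> L * norm x"
    using bounded_op_bound [OF assms(2)] by blast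
  have "norm (S x + T x) \<le> (K + L) * norm x" for x
    using norm_triangle_ineq [of "S x" "T x"] K [of x] L [of x] by (simp add: distrib_right)
  then show ?thesis
    using assms by (intro bounded_opI) (auto simp: bounded_op_def scaleC_add_right)
qed

lemma bounded_op_diff_op:
  assumes "bounded_op S" "bounded_op T"
  shows "bounded_op (\<lambda>x. S x - T x)"
  using bounded_op_add_op [OF assms(1) bounded_op_scaleR_op [OF assms(2), of "- 1"]] by simp

lemma bounded_op_funpow: "bounded_op T \<Longrightarrow> bounded_op (T ^^ n)"
proof (induction n)
  case 0
  then show ?case by (simp add: bounded_op_id id_def)
next
  case (Suc n)
  then show ?case by (simp add: bounded_op_compose comp_def)
qed

section \<open>Riesz representation, adjoints and projections\<close>

definition csubspace :: "'a::complex_hilbert set \<Rightarrow> bool" where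
  "csubspace M \<longleftrightarrow> 0 \<in> M \<and> (\<forall>x\<in>M. \<forall>y\<in>M. x + y \<in> M) \<and> (\<forall>c. \<forall>x\<in>M. scaleC c x \<in> M)"

text \<open>For small \<open>t\<close> of suitable sign the linear term wins. This is the
  first-order condition behind both Riesz representation and the kernel of a positive form.\<close>

lemma quadratic_nonneg_imp_zero:
  fixes a b :: real
  assumes "\<And>t. 0 \<le> t * a + t\<^sup>2 * b"
  shows "a = 0"
proof (rule ccontr)
  assume "a \<noteq> 0"
  \<comment> \<open>A positive number above \<open>b\<close>, whatever the sign of \<open>b\<close>,
    so that the step \<open>- a / s\<close> makes the quadratic negative.\<close>
  define s where "s = 1 + \<bar>b\<bar>"
  have s: "s > 0" "b < s" by (auto simp: s_def)
  define t where "t = - a / s"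
  have "t * a + t\<^sup>2 * b = (a\<^sup>2 / s) * (b / s - 1)"
    using s by (simp add: t_def power2_eq_square field_simps)
  moreover have "b / s - 1 < 0" "a\<^sup>2 / s > 0"
    using s \<open>a \<noteq> 0\<close> by (simp_all add: field_simps)
  ultimately have "t * a + t\<^sup>2 * b < 0"
    by (metis mult_pos_neg)
  then show False
    using assms [of t] by linarith
qed

text \<open>The representing vector minimises \<open>\<parallel>x\<parallel>\<^sup>2 - 2 Re (f x)\<close>; for \<open>M = UNIV\<close> this
  gives adjoints, for \<open>f = \<langle>_, y\<rangle>\<close> the orthogonal projection of \<open>y\<close> to \<open>M\<close>.\<close>

lemma Riesz_representation:
  fixes f :: "'a::complex_hilbert \<Rightarrow> complex"
  assumes M: "csubspace M" "closed M"
    and add: "\<And>x y. f (x + y) = f x + f y" and scale: "\<And>c x. f (scaleC c x) = c * f x"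
    and bound: "\<And>x. cmod (f x) \<le> K * norm x"
  shows "\<exists>z\<in>M. \<forall>x\<in>M. f x = cinner x z"
proof -
  define J where "J x = (norm x)\<^sup>2 - 2 * Re (f x)" for x
  have scaleR: "f (scaleR r x) = r * f x" for r x
    by (simp add: scaleR_scaleC scale)
  have bl: "bounded_linear f"
    by (rule bounded_linear_intro [where K = K])
      (use add scaleR bound in \<open>auto simp: scaleR_conv_of_real mult.commute\<close>)
  \<comment> \<open>Completing the square in \<open>norm x\<close>.\<close>
  have lower: "J x \<ge> - K\<^sup>2" for x
  proof -
    have "Re (f x) \<le> K * norm x"
      using bound [of x] complex_Re_le_cmod [of "f x"] by linarith
    moreover have "0 \<le> (norm x - K)\<^sup>2" by simp
    ultimately show ?thesis by (simp add: J_def power2_diff mult_ac)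
  qed
  define m where "m = (INF x\<in>M. J x)"
  have bdd: "bdd_below (J ` M)"
    using lower by (intro bdd_belowI2) auto
  have m_le: "m \<le> J x" if "x \<in> M" for x
    unfolding m_def using that bdd by (rule cINF_lower [rotated])
  have "M \<noteq> {}" using M by (auto simp: csubspace_def)
  have "\<exists>x\<in>M. J x < m + 1 / real (Suc k)" for k
    using cINF_less_iff [OF \<open>M \<noteq> {}\<close> bdd, of "m + 1 / real (Suc k)"] by (simp add: m_def)
  then obtain X where X: "\<And>k. X k \<in> M" "\<And>k. J (X k) < m + 1 / real (Suc k)"
    by metis
  \<comment> \<open>Parallelogram law; the terms linear in \<open>f\<close> cancel at the midpoint.
    Near-minimisers are therefore close to each other.\<close>
  have par: "J x + J y - 2 * J (scaleR (1/2) (x + y)) = (norm (x - y))\<^sup>2 / 2" for x y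
  proof -
    have "(norm (scaleR (1/2) (x + y)))\<^sup>2 = (norm (x + y))\<^sup>2 / 4"
      by (simp add: power_divide)
    moreover have "2 * Re (f (scaleR (1/2) (x + y))) = Re (f x) + Re (f y)"
      by (simp add: scaleR add)
    ultimately show ?thesis
      by (simp add: J_def norm_add_sq norm_diff_sq field_simps)
  qed
  have half: "scaleR (1/2) (x + y) \<in> M" if "x \<in> M" "y \<in> M" for x y
    using that M by (simp add: csubspace_def scaleR_scaleC)
  have diff: "(norm (X i - X j))\<^sup>2 \<le> 2 * (1 / real (Suc i) + 1 / real (Suc j))" for i j
  proof -
    have "(norm (X i - X j))\<^sup>2 / 2 = J (X i) + J (X j) - 2 * J (scaleR (1/2) (X i + X j))"
      by (rule par [symmetric])
    also have "\<dots> \<le> (m + 1 / real (Suc i)) + (m + 1 / real (Suc j)) - 2 * m"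
      using X(2) [of i] X(2) [of j] m_le [OF half [OF X(1) [of i] X(1) [of j]]] by linarith
    finally show ?thesis by simp
  qed
  have "Cauchy X"
  proof (rule CauchyI)
    fix e :: real assume "e > 0"
    obtain N where N: "4 / e\<^sup>2 < real N" using reals_Archimedean2 by blast
    have "norm (X i - X j) < e" if "i \<ge> N" "j \<ge> N" for i j
    proof -
      have "4 / e\<^sup>2 < real (Suc N)" using N by simp
      then have "4 * (1 / real (Suc N)) < e\<^sup>2" using \<open>e > 0\<close> by (simp add: field_simps)
      moreover have "1 / real (Suc i) \<le> 1 / real (Suc N)" "1 / real (Suc j) \<le> 1 / real (Suc N)"
        using that by (auto intro!: divide_left_mono)
      moreover have "(norm (X i - X j))\<^sup>2 \<le> 2 * (1 / real (Suc i)) + 2 * (1 / real (Suc j))"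
        using diff [of i j] by (simp only: distrib_left)
      ultimately have "(norm (X i - X j))\<^sup>2 < e\<^sup>2"
        by argo
      then show ?thesis using \<open>e > 0\<close> by (simp add: power_less_imp_less_base)
    qed
    then show "\<exists>N. \<forall>i\<ge>N. \<forall>j\<ge>N. norm (X i - X j) < e" by blast
  qed
  then obtain z where z: "X \<longlonglongrightarrow> z" using Cauchy_convergent convergent_def by blast
  have "z \<in> M" using closed_sequentially [OF M(2)] X(1) z by blast
  have "(\<lambda>k. J (X k)) \<longlonglongrightarrow> J z"
    unfolding J_def
    by (intro tendsto_diff tendsto_mult tendsto_const tendsto_power tendsto_norm tendsto_Re z
        bounded_linear.tendsto [OF bl])
  moreover have "(\<lambda>k. m + 1 / real (Suc k)) \<longlonglongrightarrow> m + 0"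
    by (intro tendsto_add tendsto_const LIMSEQ_Suc [OF lim_1_over_n])
  ultimately have Jz: "J z \<le> m"
    using X(2) by (intro LIMSEQ_le [where X = "\<lambda>k. J (X k)"]) (auto intro: less_imp_le)
  \<comment> \<open>Varying the minimiser \<open>z\<close> in the direction \<open>x\<close> by real
    multiples sees real parts only; the imaginary part follows from the direction \<i> x.\<close>
  have re: "Re (f x) = Re (cinner x z)" if "x \<in> M" for x
  proof -
    have "0 \<le> t * (2 * (Re (cinner z x) - Re (f x))) + t\<^sup>2 * (norm x)\<^sup>2" for t
    proof -
      have "z + scaleR t x \<in> M"
        using M \<open>z \<in> M\<close> that by (simp add: csubspace_def scaleR_scaleC)
      then have "J z \<le> J (z + scaleR t x)" using m_le Jz order_trans by blast
      then show ?thesis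
        by (simp add: J_def norm_add_sq add scaleR cinner_scaleR_right power_mult_distrib
            algebra_simps)
    qed
    from quadratic_nonneg_imp_zero [OF this] show ?thesis
      by (simp add: Re_cinner_commute [of z x])
  qed
  have "f x = cinner x z" if "x \<in> M" for x
  proof (rule complex_eqI)
    show "Re (f x) = Re (cinner x z)" by (rule re [OF that])
    have "scaleC \<i> x \<in> M" using M that by (simp add: csubspace_def)
    from re [OF this] show "Im (f x) = Im (cinner x z)"
      by (simp add: scale cinner_scaleC_left)
  qed
  then show ?thesis using \<open>z \<in> M\<close> by blast
qed

section \<open>Adjoints\<close>

text \<open>\<open>adj\<close> is a definite description. Its existence (Riesz for each
  \<open>y\<close>) and uniqueness are settled here, and all later facts about \<open>adj\<close>
  rest on this identity.\<close>

lemma cinner_adj_right: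
  assumes T: "bounded_op T"
  shows "cinner (T x) y = cinner x (adj T y)"
proof -
  obtain K where K: "K > 0" "\<And>x. norm (T x) \<le> K * norm x"
    using bounded_op_bound [OF T] by blast
  have "\<exists>z\<in>UNIV. \<forall>x\<in>UNIV. cinner (T x) y = cinner x z" for y
  proof (rule Riesz_representation [where K = "K * norm y"])
    show "cmod (cinner (T x) y) \<le> K * norm y * norm x" for x
    proof -
      have "cmod (cinner (T x) y) \<le> norm (T x) * norm y" by (rule Cauchy_Schwarz_cinner)
      also have "\<dots> \<le> (K * norm x) * norm y" by (intro mult_right_mono K) auto
      finally show ?thesis by (simp add: mult_ac)
    qed
  qed (auto simp: csubspace_def bounded_op_add [OF T] bounded_op_scaleC [OF T] cinner_add_left
        cinner_scaleC_left)
  then have "\<forall>y. \<exists>z. \<forall>x. cinner (T x) y = cinner x z" by simp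
  from choice [OF this] obtain S where "\<forall>y x. cinner (T x) y = cinner x (S y)" ..
  then have S: "\<forall>x y. cinner (T x) y = cinner x (S y)" by simp
  have "\<forall>x y. cinner (T x) y = cinner x (adj T y)"
    unfolding adj_def
  proof (rule theI [where P = "\<lambda>S. \<forall>x y. cinner (T x) y = cinner x (S y)", OF S])
    fix S' assume "\<forall>x y. cinner (T x) y = cinner x (S' y)"
    with S have "cinner x (S' y) = cinner x (S y)" for x y by metis
    then show "S' = S" by (intro ext cinner_ext_right)
  qed
  then show ?thesis by blast
qed

lemma cinner_adj_left: "bounded_op T \<Longrightarrow> cinner (adj T x) y = cinner x (T y)"
  by (subst cinner_commute, subst cinner_adj_right [symmetric]) (auto simp flip: cinner_commute)

lemma adj_eqI:
  assumes "bounded_op T" "\<And>x y. cinner (T x) y = cinner x (S y)"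
  shows "adj T = S"
  by (intro ext cinner_ext_right) (simp flip: assms(2) cinner_adj_right [OF assms(1)])

text \<open>No operator norm is introduced; constants \<open>K\<close> stand in for it, so the bound
  has to pass to the adjoint with the same \<open>K\<close>.\<close>

lemma norm_adj_le:
  assumes T: "bounded_op T" and K: "\<And>x. norm (T x) \<le> K * norm x"
  shows "norm (adj T x) \<le> K * norm x"
proof (cases "adj T x = 0")
  case True
  have "0 \<le> K * norm x" using K [of x] norm_ge_zero order_trans by blast
  with True show ?thesis by simp
next
  case False
  have "(norm (adj T x))\<^sup>2 = Re (cinner x (T (adj T x)))"
    by (simp flip: Re_cinner_self cinner_adj_left [OF T])
  also have "\<dots> \<le> norm x * norm (T (adj T x))" by (rule Re_cinner_le)
  also have "\<dots> \<le> norm x * (K * norm (adj T x))" by (intro mult_left_mono K) auto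
  finally show ?thesis
    using False by (simp add: power2_eq_square mult_ac)
qed

lemma bounded_op_adj:
  assumes T: "bounded_op T"
  shows "bounded_op (adj T)"
proof -
  obtain K where K: "K > 0" "\<And>x. norm (T x) \<le> K * norm x"
    using bounded_op_bound [OF T] by blast
  show ?thesis
  proof (rule bounded_opI [where K = K])
    show "adj T (x + y) = adj T x + adj T y" for x y
      by (rule cinner_ext_left) (simp add: T cinner_adj_left cinner_add_left)
    show "adj T (scaleC c x) = scaleC c (adj T x)" for c x
      by (rule cinner_ext_left) (simp add: T cinner_adj_left cinner_scaleC_left)
  qed (rule norm_adj_le [OF T K(2)])
qed

lemma adj_adj: "bounded_op T \<Longrightarrow> adj (adj T) = T"
  by (rule adj_eqI) (auto simp: bounded_op_adj cinner_adj_left)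

lemma adj_comp:
  assumes "bounded_op S" "bounded_op T"
  shows "adj (\<lambda>x. S (T x)) = (\<lambda>x. adj T (adj S x))"
  by (rule adj_eqI [OF bounded_op_compose [OF assms]]) (simp add: assms [THEN cinner_adj_right])

lemma adj_shift_op:
  assumes "bounded_op S"
  shows "adj (shift_op S l) = (\<lambda>x. adj S x - scaleC (cnj l) x)"
  using assms unfolding shift_op_def
  by (intro adj_eqI bounded_op_diff_op bounded_op_scaleC_op bounded_op_id)
    (auto simp: cinner_diff_left cinner_diff_right cinner_adj_right [OF assms] cinner_scaleC_left
      cinner_scaleC_right)

lemma bounded_op_shift_op: "bounded_op S \<Longrightarrow> bounded_op (shift_op S l)"
  unfolding shift_op_def by (intro bounded_op_diff_op bounded_op_scaleC_op bounded_op_id)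

lemma adj_commute:
  assumes "bounded_op S" "bounded_op T" "\<And>x. S (T x) = T (S x)"
  shows "adj S (adj T x) = adj T (adj S x)"
proof (rule cinner_ext_right)
  show "cinner z (adj S (adj T x)) = cinner z (adj T (adj S x))" for z
    by (simp add: assms(3) flip: cinner_adj_right [OF assms(1)] cinner_adj_right [OF assms(2)])
qed

lemma adj_funpow: "bounded_op T \<Longrightarrow> adj (T ^^ n) = adj T ^^ n"
proof (induction n)
  case 0
  then show ?case by (intro adj_eqI) (auto simp: bounded_op_id id_def)
next
  case (Suc n)
  have "adj (\<lambda>x. T ((T ^^ n) x)) = (\<lambda>x. adj (T ^^ n) (adj T x))"
    by (rule adj_comp [OF Suc.prems bounded_op_funpow [OF Suc.prems]])
  then show ?case
    by (simp add: Suc.IH [OF Suc.prems] comp_def funpow_swap1 fun_eq_iff)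
qed

section \<open>Self-adjoint operators and orthogonal projections\<close>

definition selfadj_op :: "('a::complex_hilbert \<Rightarrow> 'a) \<Rightarrow> bool" where
  "selfadj_op T \<longleftrightarrow> bounded_op T \<and> (\<forall>x y. cinner (T x) y = cinner x (T y))"

lemma selfadj_opI: "bounded_op T \<Longrightarrow> (\<And>x y. cinner (T x) y = cinner x (T y)) \<Longrightarrow> selfadj_op T"
  and selfadj_op_bounded: "selfadj_op T \<Longrightarrow> bounded_op T"
  and selfadj_op_cinner: "selfadj_op T \<Longrightarrow> cinner (T x) y = cinner x (T y)"
  by (simp_all add: selfadj_op_def)

lemma selfadj_op_adj: "selfadj_op T \<Longrightarrow> adj T = T"
  unfolding selfadj_op_def by (rule adj_eqI) blast+

definition proj_op :: "('a::complex_hilbert \<Rightarrow> 'a) \<Rightarrow> bool" where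
  "proj_op E \<longleftrightarrow> selfadj_op E \<and> (\<forall>x. E (E x) = E x)"

lemma proj_op_bounded: "proj_op E \<Longrightarrow> bounded_op E"
  and proj_op_cinner: "proj_op E \<Longrightarrow> cinner (E x) y = cinner x (E y)"
  and proj_op_idem: "proj_op E \<Longrightarrow> E (E x) = E x"
  by (simp_all add: proj_op_def selfadj_op_def)

lemma norm_proj_le:
  assumes E: "proj_op E"
  shows "norm (E x) \<le> norm x"
proof (cases "E x = 0")
  case False
  have "(norm (E x))\<^sup>2 = Re (cinner (E x) x)"
    by (simp add: proj_op_cinner [OF E, of x x] proj_op_cinner [OF E, of x "E x"]
        proj_op_idem [OF E] flip: Re_cinner_self)
  also have "\<dots> \<le> norm (E x) * norm x" by (rule Re_cinner_le)
  finally show ?thesis using False by (simp add: power2_eq_square)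
qed simp

text \<open>Closed subspaces are represented from here on by the condition \<open>E x = x\<close> on
  a projection; the pieces of the localisation appear only in this form.\<close>

lemma projection_exists:
  fixes M :: "'a::complex_hilbert set"
  assumes M: "csubspace M" "closed M"
  shows "\<exists>E. proj_op E \<and> (\<forall>x. E x = x \<longleftrightarrow> x \<in> M)"
proof -
  have "\<exists>z\<in>M. \<forall>x\<in>M. cinner x y = cinner x z" for y
    by (rule Riesz_representation [OF M, where K = "norm y"])
      (auto simp: cinner_add_left cinner_scaleC_left Cauchy_Schwarz_cinner mult.commute)
  then have "\<forall>y. \<exists>z. z \<in> M \<and> (\<forall>x\<in>M. cinner x z = cinner x y)" by metis
  from choice [OF this] obtain E where "\<forall>y. E y \<in> M \<and> (\<forall>x\<in>M. cinner x (E y) = cinner x y)" ..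
  then have EM: "\<And>y. E y \<in> M" and E: "\<And>x y. x \<in> M \<Longrightarrow> cinner x (E y) = cinner x y"
    by simp_all
  have uniq: "u = v" if "u \<in> M" "v \<in> M" "\<And>x. x \<in> M \<Longrightarrow> cinner x u = cinner x v" for u v
  proof -
    have "u + scaleC (- 1) v \<in> M"
      using that(1,2) M(1) unfolding csubspace_def by blast
    then have "u - v \<in> M" using scaleC_of_real [of "- 1" v] by simp
    from that(3) [OF this] have "cinner (u - v) (u - v) = 0" by (simp add: cinner_diff_right)
    then show ?thesis by (simp add: cinner_self_norm)
  qed
  have fix_: "E x = x" if "x \<in> M" for x
    by (rule uniq [OF EM that E])
  have sa: "cinner (E x) y = cinner x (E y)" for x y
  proof -
    have "cinner (E x) y = cinner (E x) (E y)" by (rule E [OF EM, symmetric])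
    also have "\<dots> = cnj (cinner (E y) (E x))" by (rule cinner_commute)
    also have "\<dots> = cnj (cinner (E y) x)" by (simp only: E [OF EM])
    also have "\<dots> = cinner x (E y)" by (rule cinner_commute [symmetric])
    finally show ?thesis .
  qed
  have "bounded_op E"
  proof (rule bounded_opI [where K = 1])
    show "E (x + y) = E x + E y" for x y
      by (rule cinner_ext_left) (simp add: sa cinner_add_left)
    show "E (scaleC c x) = scaleC c (E x)" for c x
      by (rule cinner_ext_left) (simp add: sa cinner_scaleC_left)
    show "norm (E x) \<le> 1 * norm x" for x
    proof (cases "E x = 0")
      case False
      have "(norm (E x))\<^sup>2 = Re (cinner (E x) x)"
        using E [OF EM, of x x] by (simp flip: Re_cinner_self)
      also have "\<dots> \<le> norm (E x) * norm x" by (rule Re_cinner_le)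
      finally show ?thesis using False by (simp add: power2_eq_square)
    qed simp
  qed
  then have "proj_op E"
    using sa fix_ EM by (simp add: proj_op_def selfadj_op_def)
  moreover have "\<forall>x. E x = x \<longleftrightarrow> x \<in> M" using fix_ EM by metis
  ultimately show ?thesis by (intro exI conjI)
qed

section \<open>Positive square roots\<close>

lemma selfadj_op_Im_zero:
  assumes "selfadj_op T"
  shows "Im (cinner (T x) x) = 0"
proof -
  have "cinner (T x) x = cnj (cinner (T x) x)"
    using assms cinner_commute [of "T x" x] by (simp add: selfadj_op_def)
  then show ?thesis by (simp add: complex_eq_iff)
qed

lemma selfadj_op_adj_self:
  assumes T: "bounded_op T"
  shows "selfadj_op (\<lambda>x. adj T (T x))"
  using bounded_op_compose [OF bounded_op_adj [OF T] T]
  by (rule selfadj_opI) (simp add: cinner_adj_left [OF T] cinner_adj_right [OF T])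

lemma norm_sq_adj_self:
  "bounded_op T \<Longrightarrow> (norm (T x))\<^sup>2 = Re (cinner (adj T (T x)) x)"
  by (simp add: cinner_adj_left Re_cinner_self)

text \<open>The iteration \<open>Y \<mapsto> (X + Y\<^sup>2) / 2\<close> approximates \<open>1 - sqrt (1 - X)\<close>. The scalar iteration for
  \<open>X = 1\<close> majorises it, which gives norm convergence even when \<open>\<parallel>X\<parallel> = 1\<close>.\<close>

primrec sqrt_iter :: "('a::complex_hilbert \<Rightarrow> 'a) \<Rightarrow> nat \<Rightarrow> 'a \<Rightarrow> 'a" where
  "sqrt_iter X 0 = (\<lambda>x. 0)"
| "sqrt_iter X (Suc k) = (\<lambda>x. scaleR (1/2) (X x + sqrt_iter X k (sqrt_iter X k x)))"

primrec sqrt_majorant :: "nat \<Rightarrow> real" where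
  "sqrt_majorant 0 = 0"
| "sqrt_majorant (Suc k) = (1 + (sqrt_majorant k)\<^sup>2) / 2"

lemma sqrt_majorant_bounds: "0 \<le> sqrt_majorant k \<and> sqrt_majorant k \<le> 1"
  by (induction k) (auto intro: power_le_one)

lemma sqrt_majorant_Suc_ge: "sqrt_majorant k \<le> sqrt_majorant (Suc k)"
  using zero_le_power2 [of "1 - sqrt_majorant k"] by (simp add: power2_diff)

lemma bounded_op_sqrt_iter: "bounded_op X \<Longrightarrow> bounded_op (sqrt_iter X k)"
proof (induction k)
  case 0
  then show ?case by (simp add: bounded_op_zero_op)
next
  case (Suc k)
  then have "bounded_op (sqrt_iter X k)" by blast
  from bounded_op_scaleR_op [OF bounded_op_add_op [OF Suc.prems bounded_op_compose [OF this this]]]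
  show ?case by simp
qed

lemma sqrt_iter_commute:
  assumes "bounded_op S" "\<And>x. S (X x) = X (S x)"
  shows "S (sqrt_iter X k x) = sqrt_iter X k (S x)"
  by (induction k arbitrary: x)
    (simp_all add: bounded_op_zero [OF assms(1)] bounded_op_add [OF assms(1)]
      bounded_op_scaleR [OF assms(1)] assms(2))

text \<open>All iterates are polynomials in \<open>X\<close>; commutation is obtained by using
  \<open>sqrt_iter_commute\<close> twice.\<close>

lemma sqrt_iter_sqrt_iter:
  assumes X: "bounded_op X"
  shows "sqrt_iter X i (sqrt_iter X j x) = sqrt_iter X j (sqrt_iter X i x)"
proof (rule sqrt_iter_commute [OF bounded_op_sqrt_iter [OF X]])
  show "sqrt_iter X i (X y) = X (sqrt_iter X i y)" for y
    by (rule sqrt_iter_commute [OF X, symmetric]) simp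
qed

lemma selfadj_op_sqrt_iter: "selfadj_op X \<Longrightarrow> selfadj_op (sqrt_iter X k)"
proof (induction k)
  case 0
  then show ?case by (simp add: selfadj_op_def bounded_op_zero_op)
next
  case (Suc k)
  then have Y: "cinner (sqrt_iter X k x) y = cinner x (sqrt_iter X k y)" for x y
    by (simp add: selfadj_op_def)
  have X: "cinner (X x) y = cinner x (X y)" for x y
    using Suc.prems by (simp add: selfadj_op_def)
  show ?case
    by (rule selfadj_opI [OF bounded_op_sqrt_iter [OF selfadj_op_bounded [OF Suc.prems]]])
      (simp add: cinner_scaleR_left cinner_scaleR_right cinner_add_left cinner_add_right X Y)
qed

context
  fixes X :: "'a::complex_hilbert \<Rightarrow> 'a"
  assumes X: "selfadj_op X" and le1: "\<And>x. norm (X x) \<le> norm x"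
begin

lemma norm_sqrt_iter: "norm (sqrt_iter X k x) \<le> sqrt_majorant k * norm x"
proof (induction k arbitrary: x)
  case (Suc k)
  have "norm (sqrt_iter X k (sqrt_iter X k x)) \<le> sqrt_majorant k * norm (sqrt_iter X k x)"
    by (rule Suc.IH)
  also have "\<dots> \<le> sqrt_majorant k * (sqrt_majorant k * norm x)"
    by (intro mult_left_mono Suc.IH) (simp add: sqrt_majorant_bounds)
  finally have "norm (X x + sqrt_iter X k (sqrt_iter X k x))
      \<le> norm x + sqrt_majorant k * (sqrt_majorant k * norm x)"
    using norm_triangle_ineq [of "X x" "sqrt_iter X k (sqrt_iter X k x)"] le1 [of x] by linarith
  then show ?case
    unfolding sqrt_iter.simps sqrt_majorant.simps norm_scaleR
    by (simp add: power2_eq_square field_simps)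
qed simp

text \<open>Consecutive iterates commute, so the difference of their squares factors as sum times
  difference; the scalar majorants satisfy the same recursion with equality.\<close>

lemma norm_sqrt_iter_step:
  "norm (sqrt_iter X (Suc k) x - sqrt_iter X k x)
    \<le> (sqrt_majorant (Suc k) - sqrt_majorant k) * norm x"
proof (induction k arbitrary: x)
  case 0
  then show ?case using le1 [of x] by simp
next
  case (Suc k)
  let ?Y = "sqrt_iter X (Suc k)" and ?Z = "sqrt_iter X k"
  let ?y = "sqrt_majorant (Suc k)" and ?z = "sqrt_majorant k"
  note bY = bounded_op_sqrt_iter [OF selfadj_op_bounded [OF X], of "Suc k"]
  note bZ = bounded_op_sqrt_iter [OF selfadj_op_bounded [OF X], of k]
  define d where "d = ?Y x - ?Z x"
  have "?Y (?Y x) - ?Z (?Z x) = ?Y d + ?Z d"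
    using sqrt_iter_sqrt_iter [OF selfadj_op_bounded [OF X], of "Suc k" k x]
    by (simp add: d_def bounded_op_diff [OF bY] bounded_op_diff [OF bZ] del: sqrt_iter.simps)
  moreover have "norm (?Y d) \<le> ?y * norm d" "norm (?Z d) \<le> ?z * norm d"
    by (rule norm_sqrt_iter)+
  ultimately have "norm (?Y (?Y x) - ?Z (?Z x)) \<le> (?y + ?z) * norm d"
    using norm_triangle_ineq [of "?Y d" "?Z d"]
    by (simp add: distrib_right del: sqrt_iter.simps sqrt_majorant.simps)
  also have "\<dots> \<le> (?y + ?z) * ((?y - ?z) * norm x)"
    unfolding d_def by (intro mult_left_mono Suc.IH) (metis add_nonneg_nonneg sqrt_majorant_bounds)
  finally have *: "norm (?Y (?Y x) - ?Z (?Z x)) \<le> (?y\<^sup>2 - ?z\<^sup>2) * norm x"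
    by (simp add: power2_eq_square algebra_simps del: sqrt_majorant.simps sqrt_iter.simps)
  have eq1: "sqrt_iter X (Suc (Suc k)) x - ?Y x = scaleR (1/2) (?Y (?Y x) - ?Z (?Z x))"
    unfolding sqrt_iter.simps(2) [of X "Suc k"] scaleR_diff_right
    by (simp add: scaleR_add_right)
  have eq2: "sqrt_majorant (Suc (Suc k)) - ?y = (?y\<^sup>2 - ?z\<^sup>2) / 2"
    unfolding sqrt_majorant.simps(2) [of "Suc k"] by (simp add: field_simps)
  show ?case
    unfolding eq1 eq2 norm_scaleR using * by simp
qed

lemma norm_sqrt_iter_diff:
  "i \<le> j \<Longrightarrow> norm (sqrt_iter X j x - sqrt_iter X i x)
    \<le> (sqrt_majorant j - sqrt_majorant i) * norm x"
proof (induction j rule: dec_induct)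
  case (step j)
  have "norm (sqrt_iter X (Suc j) x - sqrt_iter X i x)
      \<le> norm (sqrt_iter X (Suc j) x - sqrt_iter X j x) + norm (sqrt_iter X j x - sqrt_iter X i x)"
    using norm_triangle_ineq [of "sqrt_iter X (Suc j) x - sqrt_iter X j x"
        "sqrt_iter X j x - sqrt_iter X i x"] by simp
  also have "\<dots> \<le> (sqrt_majorant (Suc j) - sqrt_majorant j) * norm x
      + (sqrt_majorant j - sqrt_majorant i) * norm x"
    using norm_sqrt_iter_step step.IH by (rule add_mono)
  finally show ?case by (simp add: left_diff_distrib)
qed simp

lemma convergent_sqrt_iter: "convergent (\<lambda>k. sqrt_iter X k x)"
proof -
  have "convergent sqrt_majorant"
    by (rule Bseq_mono_convergent [OF BseqI' [of _ 1]])
      (use sqrt_majorant_bounds lift_Suc_mono_le [where f = sqrt_majorant, OF sqrt_majorant_Suc_ge] in auto)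
  then have C: "Cauchy sqrt_majorant" by (rule convergent_Cauchy)
  have "Cauchy (\<lambda>k. sqrt_iter X k x)"
  proof (rule CauchyI')
    fix e :: real assume "e > 0"
    \<comment> \<open>The summand 1 covers \<open>x = 0\<close>.\<close>
    then have "e / (norm x + 1) > 0" by (simp add: add_nonneg_pos)
    from metric_CauchyD [OF C this] obtain N where
      N: "\<And>m n. m \<ge> N \<Longrightarrow> n \<ge> N \<Longrightarrow> dist (sqrt_majorant m) (sqrt_majorant n) < e / (norm x + 1)"
      by blast
    have "norm (sqrt_iter X m x - sqrt_iter X n x) < e" if "m \<ge> N" "n > m" for m n
    proof -
      have "norm (sqrt_iter X m x - sqrt_iter X n x) \<le> (sqrt_majorant n - sqrt_majorant m) * norm x"
        using norm_sqrt_iter_diff [of m n x] that by (simp add: norm_minus_commute)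
      also have "\<dots> \<le> (e / (norm x + 1)) * norm x"
        using N [of n m] that by (intro mult_right_mono) (auto simp: dist_real_def)
      also have "\<dots> < e"
        using \<open>e > 0\<close> by (simp add: field_simps add_pos_nonneg)
      finally show ?thesis .
    qed
    then show "\<exists>M. \<forall>m\<ge>M. \<forall>n>m. dist (sqrt_iter X m x) (sqrt_iter X n x) < e"
      unfolding dist_norm by blast
  qed
  then show ?thesis by (simp add: Cauchy_convergent_iff)
qed

text \<open>The fixed-point equation 2 Y = X + Y^2 says (1 - Y)^2 = 1 - X, so 1 - Y is the root that
  is sought. Commutation with \<open>S\<close> passes from the iterates to the limit.\<close>

lemma sqrt_one_minus_exists:
  "\<exists>Y. selfadj_op Y \<and> (\<forall>x. norm (Y x) \<le> norm x) \<and> (\<forall>x. scaleR 2 (Y x) = X x + Y (Y x)) \<and>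
    (\<forall>S. bounded_op S \<longrightarrow> (\<forall>x. S (X x) = X (S x)) \<longrightarrow> (\<forall>x. S (Y x) = Y (S x)))"
proof -
  let ?Y = "sqrt_iter X"
  define Y where "Y x = lim (\<lambda>k. ?Y k x)" for x
  have lim: "(\<lambda>k. ?Y k x) \<longlonglongrightarrow> Y x" for x
    using convergent_sqrt_iter unfolding Y_def by (simp add: convergent_LIMSEQ_iff)
  note bd = bounded_op_sqrt_iter [OF selfadj_op_bounded [OF X]]
  have nk: "norm (?Y k x) \<le> norm x" for k x
  proof -
    have "norm (?Y k x) \<le> sqrt_majorant k * norm x" by (rule norm_sqrt_iter)
    also have "\<dots> \<le> 1 * norm x"
      by (intro mult_right_mono) (simp_all add: sqrt_majorant_bounds)
    finally show ?thesis by simp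
  qed
  have nY: "norm (Y x) \<le> norm x" for x
    by (rule LIMSEQ_le_const2 [OF tendsto_norm [OF lim]]) (use nk in blast)
  have bY: "bounded_op Y"
  proof (rule bounded_opI [where K = 1])
    show "Y (x + y) = Y x + Y y" for x y
      using tendsto_add [OF lim [of x] lim [of y]]
      by (intro LIMSEQ_unique [OF lim]) (simp add: bounded_op_add [OF bd])
    show "Y (scaleC c x) = scaleC c (Y x)" for c x
      using tendsto_scaleC [OF lim [of x], of c]
      by (intro LIMSEQ_unique [OF lim]) (simp add: bounded_op_scaleC [OF bd])
  qed (simp add: nY)
  have saY: "cinner (Y x) y = cinner x (Y y)" for x y
  proof (rule LIMSEQ_unique)
    show "(\<lambda>k. cinner (?Y k x) y) \<longlonglongrightarrow> cinner (Y x) y"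
      by (intro tendsto_cinner lim tendsto_const)
    show "(\<lambda>k. cinner (?Y k x) y) \<longlonglongrightarrow> cinner x (Y y)"
      unfolding selfadj_op_cinner [OF selfadj_op_sqrt_iter [OF X]]
      by (intro tendsto_cinner lim tendsto_const)
  qed
  \<comment> \<open>Convergence is only pointwise; the uniform bound \<open>nk\<close> lets the
    product of the two converging factors converge.\<close>
  have sq: "(\<lambda>k. ?Y k (?Y k x)) \<longlonglongrightarrow> Y (Y x)" for x
  proof -
    have "(\<lambda>k. ?Y k (?Y k x - Y x)) \<longlonglongrightarrow> 0"
    proof (rule Lim_null_comparison)
      show "\<forall>\<^sub>F k in sequentially. norm (?Y k (?Y k x - Y x)) \<le> norm (?Y k x - Y x)"
        by (simp add: nk)
      show "(\<lambda>k. norm (?Y k x - Y x)) \<longlonglongrightarrow> 0"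
        using lim [of x] by (simp add: LIM_zero tendsto_norm_zero)
    qed
    from tendsto_add [OF this lim [of "Y x"]] show ?thesis
      by (simp add: bounded_op_diff [OF bd])
  qed
  have eq: "scaleR 2 (Y x) = X x + Y (Y x)" for x
  proof (rule LIMSEQ_unique)
    show "(\<lambda>k. scaleR 2 (?Y (Suc k) x)) \<longlonglongrightarrow> scaleR 2 (Y x)"
      by (intro tendsto_scaleR tendsto_const LIMSEQ_Suc [OF lim])
    show "(\<lambda>k. scaleR 2 (?Y (Suc k) x)) \<longlonglongrightarrow> X x + Y (Y x)"
      using tendsto_add [OF tendsto_const sq [of x], of "X x"] by simp
  qed
  have "S (Y x) = Y (S x)" if S: "bounded_op S" "\<forall>x. S (X x) = X (S x)" for S x
  proof (rule LIMSEQ_unique)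
    show "(\<lambda>k. S (?Y k x)) \<longlonglongrightarrow> S (Y x)" by (rule bounded_op_tendsto [OF S(1) lim])
    have "S (?Y k x) = ?Y k (S x)" for k
      using S(2) by (intro sqrt_iter_commute [OF S(1)]) simp
    then show "(\<lambda>k. S (?Y k x)) \<longlonglongrightarrow> Y (S x)" by (simp add: lim)
  qed
  then show ?thesis
    using selfadj_opI [OF bY saY] nY eq by (intro exI [of _ Y]) blast
qed

end

lemma positive_op_one_minus:
  assumes Y: "selfadj_op Y" and "\<And>x. norm (Y x) \<le> norm x"
  shows "0 \<le> Re (cinner (x - Y x) x)"
proof -
  have "Re (cinner (Y x) x) \<le> norm (Y x) * norm x" by (rule Re_cinner_le)
  also have "\<dots> \<le> norm x * norm x" using assms(2) by (rule mult_right_mono) simp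
  finally show ?thesis
    by (simp add: cinner_diff_left Re_cinner_self power2_eq_square)
qed

text \<open>The last clause puts \<open>R\<close> into the bicommutant of \<open>P\<close>; the
  uniqueness of the root and the construction of spectral cuts both use it.\<close>

definition is_sqrt :: "('a::complex_hilbert \<Rightarrow> 'a) \<Rightarrow> ('a \<Rightarrow> 'a) \<Rightarrow> bool" where
  "is_sqrt R P \<longleftrightarrow> selfadj_op R \<and> (\<forall>x. 0 \<le> Re (cinner (R x) x)) \<and> (\<forall>x. R (R x) = P x) \<and>
    (\<forall>S. bounded_op S \<longrightarrow> (\<forall>x. S (P x) = P (S x)) \<longrightarrow> (\<forall>x. S (R x) = R (S x)))"

lemma sqrt_exists_contraction:
  assumes T: "bounded_op T" and le1: "\<And>x. norm (T x) \<le> norm x"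
  shows "\<exists>R. is_sqrt R (\<lambda>x. adj T (T x))"
proof -
  let ?P = "\<lambda>x. adj T (T x)"
  let ?X = "\<lambda>x. x - ?P x"
  have P: "selfadj_op ?P" by (rule selfadj_op_adj_self [OF T])
  have X: "selfadj_op ?X"
    using selfadj_op_cinner [OF P]
    by (intro selfadj_opI bounded_op_diff_op bounded_op_id selfadj_op_bounded [OF P])
      (simp add: cinner_diff_left cinner_diff_right)
  \<comment> \<open>With P = \<open>adj T\<close> T, |x - P x|^2 = |x|^2 - 2 |T x|^2 + |P x|^2, and
    |P x| \<le> |T x|.\<close>
  have leX: "norm (?X x) \<le> norm x" for x
  proof (rule power2_le_imp_le)
    have "norm (?P x) \<le> norm (T x)" using norm_adj_le [OF T, of 1] le1 by simp
    then have "(norm (?P x))\<^sup>2 \<le> (norm (T x))\<^sup>2" by (rule power_mono) simp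
    moreover have "Re (cinner x (?P x)) = (norm (T x))\<^sup>2"
      by (simp add: norm_sq_adj_self [OF T] Re_cinner_commute [of x])
    ultimately show "(norm (?X x))\<^sup>2 \<le> (norm x)\<^sup>2"
      using zero_le_power2 [of "norm (T x)"] unfolding norm_diff_sq by linarith
  qed simp
  obtain Y where Y: "selfadj_op Y" "\<forall>x. norm (Y x) \<le> norm x"
    and eq: "\<forall>x. scaleR 2 (Y x) = ?X x + Y (Y x)"
    and comm: "\<forall>S. bounded_op S \<longrightarrow> (\<forall>x. S (?X x) = ?X (S x)) \<longrightarrow> (\<forall>x. S (Y x) = Y (S x))"
    using sqrt_one_minus_exists [OF X leX] by blast
  note bY = selfadj_op_bounded [OF Y(1)]
  define R where "R x = x - Y x" for x
  have "selfadj_op R"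
    unfolding R_def using selfadj_op_cinner [OF Y(1)]
    by (intro selfadj_opI bounded_op_diff_op bounded_op_id bY)
      (simp add: cinner_diff_left cinner_diff_right)
  moreover have "0 \<le> Re (cinner (R x) x)" for x
    unfolding R_def using Y by (intro positive_op_one_minus) auto
  moreover have "R (R x) = ?P x" for x
  proof -
    have "R (R x) = x - scaleR 2 (Y x) + Y (Y x)"
      by (simp add: R_def bounded_op_diff [OF bY] scaleR_2)
    then show ?thesis using eq by simp
  qed
  moreover have "S (R x) = R (S x)" if S: "bounded_op S" "\<forall>x. S (?P x) = ?P (S x)" for S x
  proof -
    have "\<forall>x. S (?X x) = ?X (S x)" using S(2) by (simp add: bounded_op_diff [OF S(1)])
    then have "S (Y x) = Y (S x)" using comm S(1) by blast
    then show ?thesis by (simp add: R_def bounded_op_diff [OF S(1)])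
  qed
  ultimately show ?thesis
    unfolding is_sqrt_def by (intro exI [of _ R]) blast
qed

lemma sqrt_exists:
  assumes T: "bounded_op T"
  shows "\<exists>R. is_sqrt R (\<lambda>x. adj T (T x))"
proof -
  obtain K where K: "K > 0" "\<And>x. norm (T x) \<le> K * norm x"
    using bounded_op_bound [OF T] by blast
  define U where "U x = scaleR (1 / K) (T x)" for x
  have U: "bounded_op U" unfolding U_def by (rule bounded_op_scaleR_op [OF T])
  have "norm (U x) \<le> norm x" for x
    using K(1) K(2) [of x] by (simp add: U_def field_simps)
  then obtain R where R: "is_sqrt R (\<lambda>x. adj U (U x))"
    using sqrt_exists_contraction [OF U] by blast
  have adjU: "adj U = (\<lambda>x. scaleR (1 / K) (adj T x))"
    by (rule adj_eqI [OF U])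
      (simp add: U_def cinner_scaleR_left cinner_scaleR_right cinner_adj_right [OF T])
  have P: "adj T (T x) = scaleR (K\<^sup>2) (adj U (U x))" for x
    using K(1) by (simp add: adjU U_def bounded_op_scaleR [OF bounded_op_adj [OF T]] power2_eq_square)
  have P': "adj U (U x) = scaleR (1 / K\<^sup>2) (adj T (T x))" for x
    using K(1) by (simp add: P)
  define Q where "Q x = scaleR K (R x)" for x
  have saR: "selfadj_op R" and posR: "\<And>x. 0 \<le> Re (cinner (R x) x)"
    and RR: "\<And>x. R (R x) = adj U (U x)"
    and commR: "\<And>S x. bounded_op S \<Longrightarrow> \<forall>x. S (adj U (U x)) = adj U (U (S x)) \<Longrightarrow> S (R x) = R (S x)"
    using R unfolding is_sqrt_def by blast+
  note bR = selfadj_op_bounded [OF saR]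
  have "selfadj_op Q"
    unfolding Q_def
    by (rule selfadj_opI [OF bounded_op_scaleR_op [OF bR]])
      (simp add: cinner_scaleR_left cinner_scaleR_right selfadj_op_cinner [OF saR])
  moreover have "0 \<le> Re (cinner (Q x) x)" for x
    using K(1) posR [of x] by (simp add: Q_def cinner_scaleR_left)
  moreover have "Q (Q x) = adj T (T x)" for x
    by (simp add: Q_def bounded_op_scaleR [OF bR] RR P power2_eq_square)
  moreover have "S (Q x) = Q (S x)"
    if S: "bounded_op S" "\<forall>x. S (adj T (T x)) = adj T (T (S x))" for S x
  proof -
    have "\<forall>x. S (adj U (U x)) = adj U (U (S x))"
      using S(2) by (simp add: P' bounded_op_scaleR [OF S(1)])
    from commR [OF S(1) this] show ?thesis by (simp add: Q_def bounded_op_scaleR [OF S(1)])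
  qed
  ultimately show ?thesis
    unfolding is_sqrt_def by (intro exI [of _ Q]) blast
qed

section \<open>Uniqueness of positive roots, absolute values, paranormality\<close>

text \<open>Moving from \<open>y\<close> by \<open>t\<close> times \<open>R y\<close> changes the
  form to first order by 2 t |R y|^2. A nonnegative form with value 0 at \<open>y\<close> cannot
  have a nonzero first-order term.\<close>

lemma positive_form_zero:
  assumes R: "selfadj_op R" and pos: "\<And>x. 0 \<le> Re (cinner (R x) x)"
    and zero: "Re (cinner (R y) y) = 0"
  shows "R y = 0"
proof -
  note bR = selfadj_op_bounded [OF R]
  have "0 \<le> t * (2 * (norm (R y))\<^sup>2) + t\<^sup>2 * Re (cinner (R (R y)) (R y))" for t
  proof -
    have "Re (cinner (R (R y)) y) = (norm (R y))\<^sup>2"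
      by (simp add: selfadj_op_cinner [OF R, of "R y" y] Re_cinner_self)
    moreover have "Re (cinner (R (y + scaleR t (R y))) (y + scaleR t (R y))) =
        Re (cinner (R y) y) + t * (norm (R y))\<^sup>2 + t * Re (cinner (R (R y)) y)
        + t * t * Re (cinner (R (R y)) (R y))"
      by (simp add: bounded_op_add [OF bR] bounded_op_scaleR [OF bR] cinner_add_left
          cinner_add_right cinner_scaleR_left cinner_scaleR_right Re_cinner_self)
        (simp add: algebra_simps)
    ultimately show ?thesis
      using pos [of "y + scaleR t (R y)"] zero by (simp add: power2_eq_square)
  qed
  from quadratic_nonneg_imp_zero [OF this] show ?thesis by simp
qed

text \<open>A real quadratic form on a complex space forces symmetry. Needed because the competitors
  in \<open>op_sqrt\<close> are only assumed bounded and positive.\<close>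

lemma positive_op_imp_selfadj:
  assumes R: "bounded_op R" and pos: "positive_op R"
  shows "selfadj_op R"
proof (rule selfadj_opI [OF R])
  fix x y
  have real: "Im (cinner (R z) z) = 0" for z
    using pos by (simp add: positive_op_def)
  have im: "Im (cinner (R x) y) = - Im (cinner (R y) x)" for x y
    using real [of "x + y"]
    by (simp add: bounded_op_add [OF R] cinner_add_left cinner_add_right real)
  \<comment> \<open>The identity for imaginary parts, applied with \<i> y in place of
    \<open>y\<close>, is the one for real parts.\<close>
  have "Re (cinner (R x) y) = Re (cinner (R y) x)"
    using im [of x "scaleC \<i> y"]
    by (simp add: bounded_op_scaleC [OF R] cinner_scaleC_left cinner_scaleC_right)
  with im [of x y] have "cinner (R x) y = cnj (cinner (R y) x)"
    by (simp add: complex_eq_iff)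
  then show "cinner (R x) y = cinner x (R y)"
    by (simp flip: cinner_commute)
qed

lemma op_sqrt_eq:
  assumes R: "is_sqrt R P"
  shows "op_sqrt P = R"
proof -
  have saR: "selfadj_op R" and posR: "\<And>x. 0 \<le> Re (cinner (R x) x)"
    and RR: "\<And>x. R (R x) = P x"
    and commR: "\<And>S x. bounded_op S \<Longrightarrow> \<forall>x. S (P x) = P (S x) \<Longrightarrow> S (R x) = R (S x)"
    using R unfolding is_sqrt_def by blast+
  note bR = selfadj_op_bounded [OF saR]
  have "positive_op R"
    using posR selfadj_op_Im_zero [OF saR] by (simp add: positive_op_def)
  moreover have "R \<circ> R = P" using RR by (simp add: fun_eq_iff)
  moreover have "S = R" if S: "bounded_op S" "positive_op S" "S \<circ> S = P" for S
  proof
    fix x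
    note saS = positive_op_imp_selfadj [OF S(1,2)]
    have SS: "S (S z) = P z" for z using S(3) by (simp add: fun_eq_iff)
    have "S (P z) = P (S z)" for z by (simp flip: SS)
    then have SR: "S (R z) = R (S z)" for z using commR [OF S(1)] by simp
    \<comment> \<open>As \<open>R\<close> and \<open>S\<close> commute and have equal squares, R + S
      kills this difference. Both forms are nonnegative, so each vanishes at \<open>y\<close>, and
      \<open>y\<close> is orthogonal to itself.\<close>
    define y where "y = R x - S x"
    have sum0: "R y + S y = 0"
      by (simp add: y_def bounded_op_diff [OF bR] bounded_op_diff [OF S(1)] RR SS SR)
    have posS: "0 \<le> Re (cinner (S z) z)" for z
      using S(2) by (simp add: positive_op_def)
    have "Re (cinner (R y) y) + Re (cinner (S y) y) = 0"
      using sum0 by (simp flip: plus_complex.sel(1) cinner_add_left)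
    then have "Re (cinner (R y) y) = 0" "Re (cinner (S y) y) = 0"
      using posR [of y] posS [of y] by linarith+
    then have "R y = 0" "S y = 0"
      using positive_form_zero [OF saR posR] positive_form_zero [OF saS posS] by blast+
    have "cinner y y = cinner (R x) y - cinner (S x) y"
      by (simp add: y_def cinner_diff_left)
    also have "\<dots> = 0"
      by (simp add: selfadj_op_cinner [OF saR] selfadj_op_cinner [OF saS] \<open>R y = 0\<close> \<open>S y = 0\<close>)
    finally have "y = 0" by (simp add: cinner_self_norm)
    then show "S x = R x" by (simp add: y_def)
  qed
  ultimately show ?thesis
    unfolding op_sqrt_def using bR by (intro the_equality) blast+
qed

lemma op_abs_is_sqrt: "bounded_op T \<Longrightarrow> is_sqrt (op_abs T) (\<lambda>x. adj T (T x))"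
  using sqrt_exists [of T] op_sqrt_eq unfolding op_abs_def comp_def by metis

text \<open>Evaluated at \<open>x\<close>, the operator inequality bounds |S x|^2 by the form of the
  absolute value of S^2, then Cauchy-Schwarz applies; that absolute value has the same norms as
  S^2.\<close>

lemma class_A11_paranormal:
  assumes S: "bounded_op S" and A: "class_A11 S"
  shows "(norm (S x))\<^sup>2 \<le> norm (S (S x)) * norm x"
proof -
  let ?R = "op_abs (S \<circ> S)"
  have SS: "bounded_op (S \<circ> S)" unfolding comp_def by (rule bounded_op_compose [OF S S])
  have saR: "selfadj_op ?R" and RR: "\<And>x. ?R (?R x) = adj (S \<circ> S) (S (S x))"
    using op_abs_is_sqrt [OF SS] by (auto simp: is_sqrt_def)
  have abs2: "op_abs S (op_abs S z) = adj S (S z)" for z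
    using op_abs_is_sqrt [OF S] by (simp add: is_sqrt_def)
  have "(norm (?R x))\<^sup>2 = Re (cinner (adj (S \<circ> S) (S (S x))) x)"
    by (simp add: selfadj_op_cinner [OF saR, of "?R x" x] Re_cinner_self flip: RR)
  also have "\<dots> = (norm (S (S x)))\<^sup>2"
    by (simp add: cinner_adj_left [OF SS] Re_cinner_self)
  finally have norm_R: "norm (?R x) = norm (S (S x))" by simp
  have "0 \<le> Re (cinner (?R x - adj S (S x)) x)"
    using A by (simp add: class_A11_def op_le_def positive_op_def abs2)
  then have "(norm (S x))\<^sup>2 \<le> Re (cinner (?R x) x)"
    by (simp add: cinner_diff_left norm_sq_adj_self [OF S])
  also have "\<dots> \<le> norm (?R x) * norm x" by (rule Re_cinner_le)
  finally show ?thesis by (simp add: norm_R)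
qed

section \<open>Spectral projections of a normal operator\<close>

text \<open>\<open>growth\<close> says that the ratio of |T^(i+1) v| to |T^i v| satisfies r_i \<le>
  m r_(i+1), so r_0 \<le> m^i r_i. The product over i = 0, ..., n telescopes and collects the
  exponent 0 + ... + n.\<close>

lemma norm_power_le_of_growth:
  fixes T :: "'a::complex_hilbert \<Rightarrow> 'a"
  assumes growth: "\<And>w. (norm (T w))\<^sup>2 \<le> m * norm (T (T w)) * norm w" and m: "0 \<le> m"
  shows "norm (T v) ^ Suc n \<le> m ^ (\<Sum>i\<le>n. i) * norm ((T ^^ Suc n) v) * norm v ^ n"
proof (induction n arbitrary: v)
  case (Suc n)
  let ?d = "norm ((T ^^ Suc (Suc n)) v)" and ?e = "\<Sum>i\<le>n. i"
  show ?case
  proof (cases "norm (T v) = 0")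
    case False
    have IH: "norm (T (T v)) ^ Suc n \<le> m ^ ?e * ?d * norm (T v) ^ n"
      using Suc.IH [of "T v"] by (simp add: funpow_swap1)
    \<comment> \<open>The extra power of \<open>norm (T v)\<close> replaces division by the norms of
      intermediate vectors and is cancelled at the end.\<close>
    have "norm (T v) ^ Suc (Suc n) * norm (T v) ^ n = ((norm (T v))\<^sup>2) ^ Suc n"
      by (simp add: power2_eq_square power_mult_distrib)
    also have "\<dots> \<le> (m * norm (T (T v)) * norm v) ^ Suc n"
      by (rule power_mono [OF growth]) simp
    also have "\<dots> = norm (T (T v)) ^ Suc n * (m ^ Suc n * norm v ^ Suc n)"
      by (simp add: power_mult_distrib)
    also have "\<dots> \<le> (m ^ ?e * ?d * norm (T v) ^ n) * (m ^ Suc n * norm v ^ Suc n)"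
      using m by (intro mult_right_mono [OF IH]) simp
    also have "\<dots> = (m ^ (?e + Suc n) * ?d * norm v ^ Suc n) * norm (T v) ^ n"
      by (simp only: power_add mult_ac)
    finally show ?thesis
      using False by (simp only: mult_le_cancel_right sum.atMost_Suc) auto
  qed (use m in simp)
qed simp

text \<open>A spectral projection of \<open>N\<close> is a projection in the bicommutant of \<open>N\<close>.\<close>

definition spectral_proj :: "('a::complex_hilbert \<Rightarrow> 'a) \<Rightarrow> ('a \<Rightarrow> 'a) \<Rightarrow> bool" where
  "spectral_proj N G \<longleftrightarrow> proj_op G \<and>
    (\<forall>T. bounded_op T \<longrightarrow> (\<forall>x. T (N x) = N (T x)) \<longrightarrow> (\<forall>x. T (G x) = G (T x)))"

lemma spectral_projI:
  assumes "proj_op G"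
    and "\<And>T x. bounded_op T \<Longrightarrow> (\<And>x. T (N x) = N (T x)) \<Longrightarrow> T (G x) = G (T x)"
  shows "spectral_proj N G"
  unfolding spectral_proj_def
proof (intro conjI allI impI)
  show "T (G x) = G (T x)" if "bounded_op T" "\<forall>x. T (N x) = N (T x)" for T x
    using that(2) by (intro assms(2) [OF that(1)]) (rule spec)
qed (rule assms(1))

lemma spectral_proj_proj: "spectral_proj N G \<Longrightarrow> proj_op G"
  unfolding spectral_proj_def by (rule conjunct1)

lemma spectral_proj_commute:
  assumes G: "spectral_proj N G" and T: "bounded_op T" "\<And>x. T (N x) = N (T x)"
  shows "T (G x) = G (T x)"
proof -
  have "bounded_op T \<longrightarrow> (\<forall>x. T (N x) = N (T x)) \<longrightarrow> (\<forall>x. T (G x) = G (T x))"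
    using G unfolding spectral_proj_def by (elim conjE) (erule spec [of _ T])
  then show ?thesis using T by simp
qed

lemma proj_op_complement:
  assumes E: "proj_op E"
  shows "proj_op (\<lambda>x. x - E x)"
  unfolding proj_op_def
  using proj_op_cinner [OF E] bounded_op_diff [OF proj_op_bounded [OF E]] proj_op_idem [OF E]
  by (auto intro!: selfadj_opI bounded_op_diff_op bounded_op_id proj_op_bounded [OF E]
      simp: cinner_diff_left cinner_diff_right)

lemma proj_op_comp:
  assumes E: "proj_op E" and F: "proj_op F" and comm: "\<And>x. E (F x) = F (E x)"
  shows "proj_op (\<lambda>x. E (F x))"
proof -
  have "cinner (E (F x)) y = cinner x (E (F y))" for x y
    using comm [of y] by (simp add: proj_op_cinner [OF E] proj_op_cinner [OF F])
  moreover have "E (F (E (F x))) = E (F x)" for x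
    using comm [of "F x"] by (simp add: proj_op_idem [OF E] proj_op_idem [OF F])
  ultimately show ?thesis
    using bounded_op_compose [OF proj_op_bounded [OF E] proj_op_bounded [OF F]]
    unfolding proj_op_def selfadj_op_def by blast
qed

lemma spectral_proj_id: "spectral_proj N (\<lambda>x. x)"
  by (rule spectral_projI) (simp_all add: proj_op_def selfadj_op_def bounded_op_id)

lemma spectral_proj_complement:
  assumes E: "spectral_proj N E"
  shows "spectral_proj N (\<lambda>x. x - E x)"
proof -
  have "T (x - E x) = T x - E (T x)" if "bounded_op T" "\<And>x. T (N x) = N (T x)" for T x
    by (simp add: bounded_op_diff [OF that(1)] spectral_proj_commute [OF E that])
  then show ?thesis
    by (rule spectral_projI [OF proj_op_complement [OF spectral_proj_proj [OF E]]])
qed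

lemma spectral_proj_commute_N:
  assumes "spectral_proj N E" "bounded_op N"
  shows "N (E x) = E (N x)"
  by (rule spectral_proj_commute [OF assms]) simp

lemma spectral_proj_commutes:
  assumes N: "bounded_op N" and E: "spectral_proj N E" and F: "spectral_proj N F"
  shows "E (F x) = F (E x)"
  by (rule spectral_proj_commute [OF F proj_op_bounded [OF spectral_proj_proj [OF E]]])
    (simp add: spectral_proj_commute_N [OF E N])

lemma spectral_proj_comp:
  assumes N: "bounded_op N" and E: "spectral_proj N E" and F: "spectral_proj N F"
  shows "spectral_proj N (\<lambda>x. E (F x))"
proof -
  have "T (E (F x)) = E (F (T x))" if "bounded_op T" "\<And>x. T (N x) = N (T x)" for T x
    by (simp add: spectral_proj_commute [OF E that] spectral_proj_commute [OF F that])
  then show ?thesis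
    by (rule spectral_projI [OF proj_op_comp [OF spectral_proj_proj [OF E]
          spectral_proj_proj [OF F] spectral_proj_commutes [OF N E F]]])
qed

section \<open>Reducing subspaces and spectral cuts\<close>

lemma proj_op_commute:
  assumes E: "proj_op E" and S: "bounded_op S"
    and inv: "\<And>x. E x = x \<Longrightarrow> E (S x) = S x" and inv': "\<And>x. E x = x \<Longrightarrow> E (adj S x) = adj S x"
  shows "S (E x) = E (S x)"
proof (rule cinner_ext_left)
  fix y
  have i: "E (S (E z)) = S (E z)" and i': "E (adj S (E z)) = adj S (E z)" for z
    using inv inv' proj_op_idem [OF E] by blast+
  have "cinner (E (S x)) y = cinner x (adj S (E y))"
    by (simp add: proj_op_cinner [OF E] cinner_adj_right [OF S])
  also have "\<dots> = cinner x (E (adj S (E y)))" by (simp only: i')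
  also have "\<dots> = cinner (E (S (E x))) y"
    by (simp add: proj_op_cinner [OF E] cinner_adj_right [OF S])
  also have "\<dots> = cinner (S (E x)) y" by (simp only: i)
  finally show "cinner (S (E x)) y = cinner (E (S x)) y" by simp
qed

lemma normal_norm_adj:
  assumes K: "bounded_op K" and normal: "\<And>x. K (adj K x) = adj K (K x)"
  shows "norm (adj K x) = norm (K x)"
proof -
  have "(norm (adj K x))\<^sup>2 = (norm (K x))\<^sup>2"
    by (simp add: norm_sq_adj_self [OF K] norm_sq_adj_self [OF bounded_op_adj [OF K]]
        adj_adj [OF K] normal)
  then show ?thesis by simp
qed

text \<open>|K w|^2 is the inner product of \<open>adj K (K w)\<close> with \<open>w\<close>, and
  normality turns the norm of the former into that of \<open>K (K w)\<close>. The factor 1 matches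
  \<open>norm_power_le_of_growth\<close>.\<close>

lemma normal_growth:
  assumes K: "bounded_op K" and normal: "\<And>x. K (adj K x) = adj K (K x)"
  shows "(norm (K w))\<^sup>2 \<le> 1 * norm (K (K w)) * norm w"
  unfolding norm_sq_adj_self [OF K]
  using Re_cinner_le [of "adj K (K w)" w] normal_norm_adj [OF K normal, of "K w"] by simp

text \<open>If \<open>T x\<close> left the range of \<open>E\<close>, its component \<open>v\<close>
  in the kernel would satisfy |K^k v| = O(s^k) with s^2 = c, because \<open>T\<close> and
  \<open>E\<close> commute with \<open>K\<close>. But \<open>above\<close> gives |K v| > s |v|, and
  \<open>growth\<close> then makes |K^k v| grow at the strictly larger rate |K v| / |v|.\<close>

lemma invariant_of_growth:
  assumes E: "proj_op E" and K: "bounded_op K" and T: "bounded_op T"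
    and TK: "\<And>x. T (K x) = K (T x)" and EK: "\<And>x. E (K x) = K (E x)"
    and growth: "\<And>w. (norm (K w))\<^sup>2 \<le> 1 * norm (K (K w)) * norm w"
    and below: "\<And>x. E x = x \<Longrightarrow> (norm (K x))\<^sup>2 \<le> c * (norm x)\<^sup>2"
    and above: "\<And>x. E x = 0 \<Longrightarrow> x \<noteq> 0 \<Longrightarrow> c * (norm x)\<^sup>2 < (norm (K x))\<^sup>2"
    and x: "E x = x"
  shows "E (T x) = T x"
proof (rule ccontr)
  assume neq: "E (T x) \<noteq> T x"
  note bE = proj_op_bounded [OF E]
  define v where "v = T x - E (T x)"
  have v: "v \<noteq> 0" "E v = 0"
    using neq by (simp_all add: v_def bounded_op_diff [OF bE] proj_op_idem [OF E])
  have "x \<noteq> 0" using neq by (auto simp: bounded_op_zero [OF T] bounded_op_zero [OF bE])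
  have "0 \<le> c * (norm x)\<^sup>2" using below [OF x] zero_le_power2 [of "norm (K x)"] by linarith
  then have "c \<ge> 0" using \<open>x \<noteq> 0\<close> by (simp add: zero_le_mult_iff)
  define s where "s = sqrt c"
  have s: "s \<ge> 0" "s\<^sup>2 = c" using \<open>c \<ge> 0\<close> by (simp_all add: s_def)
  obtain L where L: "L > 0" "\<And>x. norm (T x) \<le> L * norm x"
    using bounded_op_bound [OF T] by blast
  have pow: "E ((K ^^ k) x) = (K ^^ k) x \<and> norm ((K ^^ k) x) \<le> s ^ k * norm x" for k
  proof (induction k)
    case (Suc k)
    let ?y = "(K ^^ k) x"
    have "(norm (K ?y))\<^sup>2 \<le> (s * norm ?y)\<^sup>2"
      using below [of ?y] Suc.IH s by (simp add: power_mult_distrib)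
    then have "norm (K ?y) \<le> s * norm ?y"
      by (rule power2_le_imp_le) (simp add: s(1))
    also have "\<dots> \<le> s * (s ^ k * norm x)" using Suc.IH s by (intro mult_left_mono) auto
    finally show ?case using Suc.IH by (simp add: EK mult.assoc)
  qed (simp add: x)
  have T_pow: "T ((K ^^ k) z) = (K ^^ k) (T z)" for k z
    by (induction k) (simp_all add: TK)
  have E_pow: "E ((K ^^ k) z) = (K ^^ k) (E z)" for k z
    by (induction k) (simp_all add: EK)
  have vpow: "norm ((K ^^ k) v) \<le> 2 * L * norm x * s ^ k" for k
  proof -
    let ?w = "T ((K ^^ k) x)"
    have "(K ^^ k) v = ?w - E ?w"
      by (simp add: v_def T_pow E_pow bounded_op_diff [OF bounded_op_funpow [OF K]])
    then have "norm ((K ^^ k) v) \<le> 2 * norm ?w"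
      using norm_triangle_ineq4 [of ?w "E ?w"] norm_proj_le [OF E, of ?w] by simp
    also have "\<dots> \<le> 2 * (L * norm ((K ^^ k) x))" using L(2) by simp
    also have "\<dots> \<le> 2 * (L * (s ^ k * norm x))" using pow L(1) by simp
    finally show ?thesis by (simp add: mult_ac)
  qed
  have bound: "norm (K v) ^ Suc k \<le> 2 * L * norm x * s ^ Suc k * norm v ^ k" for k
  proof -
    have "norm (K v) ^ Suc k \<le> norm ((K ^^ Suc k) v) * norm v ^ k"
      using norm_power_le_of_growth [OF growth, of v k] by simp
    also have "\<dots> \<le> (2 * L * norm x * s ^ Suc k) * norm v ^ k"
      by (rule mult_right_mono [OF vpow]) simp
    finally show ?thesis .
  qed
  have "(s * norm v)\<^sup>2 < (norm (K v))\<^sup>2"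
    using above [OF v(2,1)] s by (simp add: power_mult_distrib)
  then have less: "s * norm v < norm (K v)" by (rule power_less_imp_less_base) simp
  show False
  proof (cases "s = 0")
    case True
    then show False using bound [of 0] less by simp
  next
    case False
    with s have "s > 0" by simp
    define r where "r = norm (K v) / (s * norm v)"
    have "r > 1" using less \<open>s > 0\<close> v(1) by (simp add: r_def)
    then obtain k where k: "2 * L * norm x / norm v < r ^ k" using real_arch_pow by blast
    also have "r ^ k \<le> r ^ Suc k" using \<open>r > 1\<close> by (intro power_increasing) auto
    also have "\<dots> = norm (K v) ^ Suc k / (s * norm v) ^ Suc k"
      unfolding r_def by (rule power_divide)
    also have "\<dots> \<le> (2 * L * norm x * s ^ Suc k * norm v ^ k) / (s * norm v) ^ Suc k"
      using \<open>s > 0\<close> by (intro divide_right_mono [OF bound]) simp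
    also have "\<dots> = 2 * L * norm x / norm v"
      using \<open>s > 0\<close> v(1) by (simp add: power_mult_distrib)
    finally show False by simp
  qed
qed

lemma spectral_cut_exists:
  fixes K :: "'a::complex_hilbert \<Rightarrow> 'a"
  assumes K: "bounded_op K" and normal: "\<And>x. K (adj K x) = adj K (K x)"
  shows "\<exists>E. spectral_proj K E \<and> (\<forall>x. E x = x \<longrightarrow> (norm (K x))\<^sup>2 \<le> c * (norm x)\<^sup>2) \<and>
    (\<forall>x. E x = 0 \<longrightarrow> c * (norm x)\<^sup>2 \<le> (norm (K x))\<^sup>2)"
proof -
  \<comment> \<open>The form of \<open>C\<close> at \<open>x\<close> is c |x|^2 - |K x|^2.
    \<open>R\<close> below is the absolute value of \<open>C\<close>, so \<open>R x = C x\<close>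
    singles out the part where \<open>C\<close> is positive.\<close>
  define C where "C x = scaleR c x - adj K (K x)" for x
  note bK' = bounded_op_adj [OF K]
  have saC: "selfadj_op C"
    unfolding C_def using selfadj_op_cinner [OF selfadj_op_adj_self [OF K]]
    by (intro selfadj_opI bounded_op_diff_op bounded_op_scaleR_op bounded_op_id
        selfadj_op_bounded [OF selfadj_op_adj_self [OF K]])
      (simp add: cinner_diff_left cinner_diff_right cinner_scaleR_left cinner_scaleR_right)
  note bC = selfadj_op_bounded [OF saC]
  obtain R where "is_sqrt R (\<lambda>x. adj C (C x))" using sqrt_exists [OF bC] by blast
  then have saR: "selfadj_op R" and posR: "\<And>x. 0 \<le> Re (cinner (R x) x)"
    and RR: "\<And>x. R (R x) = C (C x)"
    and commR: "\<And>S x. bounded_op S \<Longrightarrow> \<forall>x. S (C (C x)) = C (C (S x)) \<Longrightarrow> S (R x) = R (S x)"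
    unfolding is_sqrt_def selfadj_op_adj [OF saC] by blast+
  note bR = selfadj_op_bounded [OF saR]
  have KC: "K (C x) = C (K x)" for x
    by (simp add: C_def bounded_op_diff [OF K] bounded_op_scaleR [OF K] normal)
  have K'C: "adj K (C x) = C (adj K x)" for x
    by (simp add: C_def bounded_op_diff [OF bK'] bounded_op_scaleR [OF bK'] normal)
  have KR: "K (R x) = R (K x)" for x by (rule commR [OF K]) (simp add: KC)
  have K'R: "adj K (R x) = R (adj K x)" for x by (rule commR [OF bK']) (simp add: K'C)
  have CR: "C (R x) = R (C x)" for x by (rule commR [OF bC]) simp
  have ReC: "Re (cinner (C x) x) = c * (norm x)\<^sup>2 - (norm (K x))\<^sup>2" for x
    by (simp add: C_def cinner_diff_left cinner_scaleR_left Re_cinner_self norm_sq_adj_self [OF K])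
  let ?M = "{x. R x = C x}"
  have "csubspace ?M"
    by (simp add: csubspace_def bounded_op_zero [OF bR] bounded_op_zero [OF bC]
        bounded_op_add [OF bR] bounded_op_add [OF bC] bounded_op_scaleC [OF bR]
        bounded_op_scaleC [OF bC])
  moreover have "closed ?M"
    by (intro closed_Collect_eq linear_continuous_on bounded_op_imp_bounded_linear bR bC)
  ultimately obtain E where E: "proj_op E" and EM: "\<And>x. E x = x \<longleftrightarrow> R x = C x"
    using projection_exists [of ?M] by auto
  note bE = proj_op_bounded [OF E]
  have EK: "K (E x) = E (K x)" for x
  proof (rule proj_op_commute [OF E K])
    show "E (K y) = K y" if "E y = y" for y using that unfolding EM by (metis KC KR)
    show "E (adj K y) = adj K y" if "E y = y" for y using that unfolding EM by (metis K'C K'R)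
  qed
  have EK': "adj K (E x) = E (adj K x)" for x
  proof (rule proj_op_commute [OF E bK'])
    show "E (adj K y) = adj K y" if "E y = y" for y using that unfolding EM by (metis K'C K'R)
    show "E (adj (adj K) y) = adj (adj K) y" if "E y = y" for y
      using that unfolding EM adj_adj [OF K] by (metis KC KR)
  qed
  have below: "(norm (K x))\<^sup>2 \<le> c * (norm x)\<^sup>2" if "E x = x" for x
    using posR [of x] ReC [of x] that unfolding EM by simp
  \<comment> \<open>(R - C)(R + C) = 0, so the range of R + C lies in that of \<open>E\<close>; on
    the kernel of \<open>E\<close> the symmetric operator R + C must vanish.\<close>
  have CE: "C x = - R x" if "E x = 0" for x
  proof -
    have "cinner (R x + C x) y = 0" for y
    proof -
      have "E (R y + C y) = R y + C y"
        unfolding EM by (simp add: bounded_op_add [OF bR] bounded_op_add [OF bC] RR CR)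
      moreover have "cinner (R x + C x) y = cinner x (R y + C y)"
        by (simp add: cinner_add_left cinner_add_right selfadj_op_cinner [OF saR]
            selfadj_op_cinner [OF saC])
      ultimately have "cinner (R x + C x) y = cinner (E x) (R y + C y)"
        by (simp add: proj_op_cinner [OF E])
      with that show ?thesis by simp
    qed
    then have "R x + C x = 0" by (intro cinner_ext_left) simp
    then show ?thesis by (simp add: add_eq_0_iff)
  qed
  have above_le: "c * (norm x)\<^sup>2 \<le> (norm (K x))\<^sup>2" if "E x = 0" for x
    using posR [of x] ReC [of x] cinner_diff_left [of 0 "R x" x] unfolding CE [OF that] by simp
  \<comment> \<open>Strictness is what \<open>invariant_of_growth\<close> requires: equality would
    force \<open>R x = 0 = C x\<close>, placing \<open>x\<close> also in the range of
    \<open>E\<close>.\<close>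
  have above: "c * (norm x)\<^sup>2 < (norm (K x))\<^sup>2" if "E x = 0" "x \<noteq> 0" for x
  proof (rule ccontr)
    assume "\<not> ?thesis"
    with above_le [OF that(1)] have "Re (cinner (C x) x) = 0" by (simp add: ReC)
    then have "Re (cinner (R x) x) = 0"
      using cinner_diff_left [of 0 "R x" x] unfolding CE [OF that(1)] by simp
    then have "R x = 0" by (rule positive_form_zero [OF saR posR])
    then have "E x = x" unfolding EM CE [OF that(1)] by simp
    with that show False by simp
  qed
  have "T (E x) = E (T x)" if T: "bounded_op T" "\<And>x. T (K x) = K (T x)" for T x
  proof (rule proj_op_commute [OF E T(1)])
    show "E (T y) = T y" if "E y = y" for y
      by (rule invariant_of_growth [OF E K T(1) T(2) EK [symmetric]
            normal_growth [OF K normal] below above that])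
    \<comment> \<open>\<open>adj T\<close> is known to commute with \<open>adj K\<close>, not with
      \<open>K\<close>. Since |\<open>adj K\<close> y| = |K y|, \<open>E\<close> is equally the cut
      for \<open>adj K\<close>, and the same invariance argument applies.\<close>
    have K': "adj T (adj K y) = adj K (adj T y)" for y
      by (rule adj_commute [OF T(1) K T(2)])
    have nK': "norm (adj K y) = norm (K y)" for y by (rule normal_norm_adj [OF K normal])
    have growth': "(norm (adj K w))\<^sup>2 \<le> 1 * norm (adj K (adj K w)) * norm w" for w
      by (rule normal_growth [OF bK']) (simp add: adj_adj [OF K] normal)
    show "E (adj T y) = adj T y" if "E y = y" for y
      by (rule invariant_of_growth [OF E bK' bounded_op_adj [OF T(1)] K' EK' [symmetric] growth'
            below [folded nK'] above [folded nK'] that])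
  qed
  then have "spectral_proj K E" by (rule spectral_projI [OF E])
  then show ?thesis using below above_le by (intro exI [of _ E]) simp
qed

section \<open>Localisation\<close>

lemma proj_pythagoras:
  assumes F: "proj_op F"
  shows "(norm y)\<^sup>2 = (norm (F y))\<^sup>2 + (norm (y - F y))\<^sup>2"
proof -
  have "cinner (F y) (y - F y) = 0"
    using proj_op_cinner [OF F, of y "y - F y"]
    by (simp add: bounded_op_diff [OF proj_op_bounded [OF F]] proj_op_idem [OF F])
  then show ?thesis using norm_add_sq [of "F y" "y - F y"] by simp
qed

lemma proj_comp_fixed:
  assumes E: "proj_op E" and F: "proj_op F" and comm: "\<And>x. E (F x) = F (E x)"
    and x: "E (F x) = x"
  shows "E x = x" "F x = x"
proof -
  have "E (E (F x)) = E (F x)" by (rule proj_op_idem [OF E])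
  then show "E x = x" by (simp add: x)
  have "F (F (E x)) = F (E x)" by (rule proj_op_idem [OF F])
  then show "F x = x" by (simp add: x flip: comm)
qed

lemma spectral_proj_comp_fixed:
  assumes N: "bounded_op N" and E: "spectral_proj N E" and F: "spectral_proj N F"
    and x: "E (F x) = x"
  shows "E x = x" "F x = x"
proof -
  have comm: "E (F y) = F (E y)" for y by (rule spectral_proj_commutes [OF N E F])
  show "E x = x" "F x = x"
    using proj_comp_fixed [where E = E and F = F, OF spectral_proj_proj [OF E]
        spectral_proj_proj [OF F] comm x]
    by blast+
qed

text \<open>Polarisation, restricted to the fixed space of \<open>G\<close>: the norm is at most
  twice the numerical radius. The case \<open>w = 0\<close> later turns a vanishing form into a
  vanishing operator.\<close>

lemma norm_le_of_numerical_radius: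
  assumes Z: "bounded_op Z" and G: "bounded_op G"
    and inv: "\<And>x. G x = x \<Longrightarrow> G (Z x) = Z x"
    and w: "\<And>x. G x = x \<Longrightarrow> cmod (cinner (Z x) x) \<le> w * (norm x)\<^sup>2"
    and x: "G x = x"
  shows "norm (Z x) \<le> 2 * w * norm x"
proof (cases "Z x = 0 \<or> x = 0")
  case True
  show ?thesis
  proof (cases "x = 0")
    case False
    have "0 \<le> w * (norm x)\<^sup>2" using w [OF x] norm_ge_zero order_trans by blast
    then have "w \<ge> 0" using False by (simp add: zero_le_mult_iff)
    then show ?thesis using True False by simp
  qed (simp add: bounded_op_zero [OF Z])
next
  case False
  define q where "q z = cinner (Z z) z" for z
  \<comment> \<open>\<open>Z x\<close> rescaled to the length of \<open>x\<close>: then the inner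
    product of \<open>Z x\<close> with \<open>y\<close> is |x| |Z x|, and the four squared norms
    below add up to 8 |x|^2.\<close>
  define y where "y = scaleR (norm x / norm (Z x)) (Z x)"
  have Gy: "G y = y" by (simp add: y_def bounded_op_scaleR [OF G] inv [OF x])
  have ny: "norm y = norm x" using False by (simp add: y_def)
  have pol: "4 * cinner (Z x) y = q (x + y) - q (x - y)
      + \<i> * q (x + scaleC \<i> y) - \<i> * q (x - scaleC \<i> y)"
    by (simp add: q_def bounded_op_add [OF Z] bounded_op_diff [OF Z] bounded_op_scaleC [OF Z]
        cinner_add_left cinner_add_right cinner_diff_left cinner_diff_right cinner_scaleC_left
        cinner_scaleC_right algebra_simps)
  have Gs: "G (x + y) = x + y" "G (x - y) = x - y" "G (x + scaleC \<i> y) = x + scaleC \<i> y"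
    "G (x - scaleC \<i> y) = x - scaleC \<i> y"
    by (simp_all add: bounded_op_add [OF G] bounded_op_diff [OF G] bounded_op_scaleC [OF G] x Gy)
  have "4 * cmod (cinner (Z x) y) = cmod (4 * cinner (Z x) y)" by (simp add: norm_mult)
  also have "\<dots> \<le> cmod (q (x + y)) + cmod (q (x - y))
      + cmod (q (x + scaleC \<i> y)) + cmod (q (x - scaleC \<i> y))"
    unfolding pol
    by (intro order_trans [OF norm_triangle_ineq4] order_trans [OF norm_triangle_ineq] add_mono)
      (simp_all add: norm_mult)
  also have "\<dots> \<le> w * (norm (x + y))\<^sup>2 + w * (norm (x - y))\<^sup>2
      + w * (norm (x + scaleC \<i> y))\<^sup>2 + w * (norm (x - scaleC \<i> y))\<^sup>2"
    unfolding q_def by (intro add_mono w Gs)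
  also have "\<dots> = 8 * w * (norm x)\<^sup>2"
    by (simp add: norm_add_sq norm_diff_sq norm_scaleC ny algebra_simps)
  finally have *: "cmod (cinner (Z x) y) \<le> 2 * w * (norm x)\<^sup>2" by simp
  have "cinner (Z x) y = complex_of_real (norm x * norm (Z x))"
    using False by (simp add: y_def cinner_scaleR_right cinner_self_norm power2_eq_square)
  with * have "norm x * norm (Z x) \<le> 2 * w * (norm x)\<^sup>2"
    by (simp add: norm_mult)
  then show ?thesis using False by (simp add: power2_eq_square)
qed

section \<open>Bisection over real parameters\<close>

definition near :: "('a::complex_hilbert \<Rightarrow> 'a) \<Rightarrow> real \<Rightarrow> real \<Rightarrow> ('a \<Rightarrow> 'a) \<Rightarrow> bool" where
  "near K b h G \<longleftrightarrow> (\<forall>x. G x = x \<longrightarrow> \<bar>(norm (K x))\<^sup>2 - b * (norm x)\<^sup>2\<bar> \<le> h * (norm x)\<^sup>2)"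

lemma nearD: "near K b h G \<Longrightarrow> G x = x \<Longrightarrow> \<bar>(norm (K x))\<^sup>2 - b * (norm x)\<^sup>2\<bar> \<le> h * (norm x)\<^sup>2"
  unfolding near_def by blast

lemma near_mono: "near K b h G \<Longrightarrow> h \<le> h' \<Longrightarrow> near K b h' G"
  unfolding near_def by (meson mult_right_mono order_trans zero_le_power2)

lemma near_comp:
  assumes N: "bounded_op N" and G: "spectral_proj N G" and F: "spectral_proj N F"
    and near: "near K b h G"
  shows "near K b h (\<lambda>x. G (F x))"
  using near spectral_proj_comp_fixed(1) [OF N G F] unfolding near_def by blast

text \<open>\<open>Q h\<close> records localisations already made for other operators, so that the lemma can be
  iterated.\<close>

lemma localize_step:
  fixes N K :: "'a::complex_hilbert \<Rightarrow> 'a" and Q :: "real \<Rightarrow> ('a \<Rightarrow> 'a) \<Rightarrow> bool"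
  assumes N: "bounded_op N" and K: "bounded_op K" and normal: "\<And>x. K (adj K x) = adj K (K x)"
    and sub: "\<And>E. spectral_proj K E \<Longrightarrow> spectral_proj N E"
    and mono: "\<And>G h h'. Q h G \<Longrightarrow> h \<le> h' \<Longrightarrow> Q h' G"
    and comp: "\<And>G F h. spectral_proj N G \<Longrightarrow> spectral_proj N F \<Longrightarrow> Q h G \<Longrightarrow> Q h (\<lambda>x. G (F x))"
    and glue: "\<And>G F. spectral_proj N G \<Longrightarrow> spectral_proj N F \<Longrightarrow> good (\<lambda>x. G (F x)) \<Longrightarrow>
      good (\<lambda>x. G (x - F x)) \<Longrightarrow> good G"
    and loc: "\<And>b. \<exists>h>0. \<forall>G. spectral_proj N G \<longrightarrow> Q h G \<longrightarrow> near K b h G \<longrightarrow> good G"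
  shows "\<exists>h>0. \<forall>G. spectral_proj N G \<longrightarrow> Q h G \<longrightarrow> good G"
proof -
  define btw where "btw a b G \<longleftrightarrow>
    (\<forall>x. G x = x \<longrightarrow> a * (norm x)\<^sup>2 \<le> (norm (K x))\<^sup>2 \<and> (norm (K x))\<^sup>2 \<le> b * (norm x)\<^sup>2)" for a b G
  define P where "P a b \<longleftrightarrow>
    (\<exists>h>0. \<forall>G. spectral_proj N G \<longrightarrow> Q h G \<longrightarrow> btw a b G \<longrightarrow> good G)" for a b
  obtain L where L: "L > 0" "\<And>x. norm (K x) \<le> L * norm x"
    using bounded_op_bound [OF K] by blast
  have "0 \<le> L\<^sup>2" by simp
  \<comment> \<open>The interval from 0 to L^2 contains all quotients |K x|^2 / |x|^2. Bolzano's
    principle needs \<open>P\<close> to survive joining adjacent intervals and to hold on all short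
    intervals around a point.\<close>
  then have "P 0 (L\<^sup>2)"
  proof (induction rule: Bolzano)
    case (trans a b c)
    from \<open>P a b\<close> obtain h1 where h1: "h1 > 0"
      "\<And>G. spectral_proj N G \<Longrightarrow> Q h1 G \<Longrightarrow> btw a b G \<Longrightarrow> good G"
      unfolding P_def by blast
    from \<open>P b c\<close> obtain h2 where h2: "h2 > 0"
      "\<And>G. spectral_proj N G \<Longrightarrow> Q h2 G \<Longrightarrow> btw b c G \<Longrightarrow> good G"
      unfolding P_def by blast
    obtain E where "spectral_proj K E"
      and below: "\<And>x. E x = x \<Longrightarrow> (norm (K x))\<^sup>2 \<le> b * (norm x)\<^sup>2"
      and above: "\<And>x. E x = 0 \<Longrightarrow> b * (norm x)\<^sup>2 \<le> (norm (K x))\<^sup>2"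
      using spectral_cut_exists [OF K normal, of b] by blast
    then have E: "spectral_proj N E" by (intro sub)
    note F = spectral_proj_complement [OF E]
    \<comment> \<open>The cut at the common endpoint splits \<open>G\<close> into two pieces, one
      for each interval; the smaller of the two radii serves both.\<close>
    have "good G" if G: "spectral_proj N G" "Q (min h1 h2) G" "btw a c G" for G
    proof (rule glue [OF G(1) E])
      note fixE = spectral_proj_comp_fixed [OF N G(1) E]
      have fixF: "G x = x" "x - E x = x" if "G (x - E x) = x" for x
        using spectral_proj_comp_fixed [OF N G(1) F that] by blast+
      show "good (\<lambda>x. G (E x))"
      proof (rule h1(2) [OF spectral_proj_comp [OF N G(1) E]])
        show "Q h1 (\<lambda>x. G (E x))" by (rule comp [OF G(1) E mono [OF G(2)]]) simp
        show "btw a b (\<lambda>x. G (E x))"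
          using G(3) fixE below unfolding btw_def by blast
      qed
      show "good (\<lambda>x. G (x - E x))"
      proof (rule h2(2) [OF spectral_proj_comp [OF N G(1) F]])
        show "Q h2 (\<lambda>x. G (x - E x))" by (rule comp [OF G(1) F mono [OF G(2)]]) simp
        have "E x = 0" if "G (x - E x) = x" for x
          using fixF(2) [OF that] by simp
        then show "btw b c (\<lambda>x. G (x - E x))"
          using G(3) fixF(1) above unfolding btw_def by blast
      qed
    qed
    then show ?case
      unfolding P_def using h1(1) h2(1) by (intro exI [of _ "min h1 h2"]) simp
  next
    case (local b)
    obtain h where h: "h > 0"
      "\<And>G. spectral_proj N G \<Longrightarrow> Q h G \<Longrightarrow> near K b h G \<Longrightarrow> good G"
      using loc [of b] by blast
    have "P u v" if uv: "u \<le> b" "b \<le> v" "v - u < h" for u v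
    proof -
      have "near K b h G" if "btw u v G" for G
        unfolding near_def
      proof (intro allI impI)
        fix x assume "G x = x"
        then have "u * (norm x)\<^sup>2 \<le> (norm (K x))\<^sup>2" "(norm (K x))\<^sup>2 \<le> v * (norm x)\<^sup>2"
          using that unfolding btw_def by blast+
        moreover have "(b - h) * (norm x)\<^sup>2 \<le> u * (norm x)\<^sup>2" "v * (norm x)\<^sup>2 \<le> (b + h) * (norm x)\<^sup>2"
          using uv by (auto intro!: mult_right_mono)
        ultimately show "\<bar>(norm (K x))\<^sup>2 - b * (norm x)\<^sup>2\<bar> \<le> h * (norm x)\<^sup>2"
          by (simp add: abs_le_iff algebra_simps)
      qed
      with h show ?thesis unfolding P_def by blast
    qed
    with h(1) show ?case by blast
  qed
  moreover have "btw 0 (L\<^sup>2) G" for G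
    unfolding btw_def using power_mono [OF L(2), where n = 2] by (simp add: power_mult_distrib)
  ultimately show ?thesis unfolding P_def by blast
qed

lemma normal_shift_op:
  assumes N: "bounded_op N" and normal: "\<And>x. N (adj N x) = adj N (N x)"
  shows "shift_op N l (adj (shift_op N l) x) = adj (shift_op N l) (shift_op N l x)"
  unfolding adj_shift_op [OF N]
  by (simp add: shift_op_def bounded_op_diff [OF N] bounded_op_scaleC [OF N]
      bounded_op_diff [OF bounded_op_adj [OF N]] bounded_op_scaleC [OF bounded_op_adj [OF N]]
      scaleC_diff_right scaleC_commute [of l] normal)

lemma spectral_proj_shift_op:
  assumes "spectral_proj (shift_op N l) E"
  shows "spectral_proj N E"
proof (rule spectral_projI [OF spectral_proj_proj [OF assms]])
  show "T (E x) = E (T x)" if T: "bounded_op T" "\<And>x. T (N x) = N (T x)" for T x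
    by (rule spectral_proj_commute [OF assms T(1)])
      (simp add: shift_op_def bounded_op_diff [OF T(1)] bounded_op_scaleC [OF T(1)] T(2))
qed

text \<open>The numbers \<open>\<bar>z\<bar>\<^sup>2\<close>, \<open>\<bar>z - 1\<bar>\<^sup>2\<close>, \<open>\<bar>z - \<i>\<bar>\<^sup>2\<close> determine \<open>z\<close>.\<close>

lemma spectral_localization:
  fixes N :: "'a::complex_hilbert \<Rightarrow> 'a"
  assumes N: "bounded_op N" and normal: "\<And>x. N (adj N x) = adj N (N x)"
    and glue: "\<And>G F. spectral_proj N G \<Longrightarrow> spectral_proj N F \<Longrightarrow> good (\<lambda>x. G (F x)) \<Longrightarrow>
      good (\<lambda>x. G (x - F x)) \<Longrightarrow> good G"
    and loc: "\<And>\<nu>. \<exists>h>0. \<forall>G. spectral_proj N G \<longrightarrow>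
      (\<forall>x. G x = x \<longrightarrow> norm (N x - scaleC \<nu> x) \<le> h * norm x) \<longrightarrow> good G"
  shows "good (\<lambda>x. x)"
proof -
  let ?K = "\<lambda>l. shift_op N l"
  have step: "\<exists>h>0. \<forall>G. spectral_proj N G \<longrightarrow> Q h G \<longrightarrow> good G"
    if mono: "\<And>G h h'. Q h G \<Longrightarrow> h \<le> h' \<Longrightarrow> Q h' G"
      and comp: "\<And>G F h. spectral_proj N G \<Longrightarrow> spectral_proj N F \<Longrightarrow> Q h G \<Longrightarrow> Q h (\<lambda>x. G (F x))"
      and loc: "\<And>b. \<exists>h>0. \<forall>G. spectral_proj N G \<longrightarrow> Q h G \<longrightarrow> near (?K l) b h G \<longrightarrow> good G"
    for l Q
  proof (rule localize_step [where N = N and K = "?K l" and Q = Q and good = good])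
    show "Q h (\<lambda>x. G (F x))" if "spectral_proj N G" "spectral_proj N F" "Q h G" for G F h
      by (rule comp [where G = G and F = F, OF that])
    show "good G" if "spectral_proj N G" "spectral_proj N F" "good (\<lambda>x. G (F x))"
      "good (\<lambda>x. G (x - F x))" for G F
      by (rule glue [where G = G and F = F, OF that])
  qed (fact N bounded_op_shift_op [OF N] normal_shift_op [OF N normal] spectral_proj_shift_op
        mono loc)+
  have base: "\<exists>h>0. \<forall>G. spectral_proj N G \<longrightarrow> near (?K 0) b0 h G \<and> near (?K 1) b1 h G \<longrightarrow>
      near (?K \<i>) b2 h G \<longrightarrow> good G" for b0 b1 b2
  proof -
    \<comment> \<open>Solves |z|^2 = b0, |z - 1|^2 = b1, |z - \<i>|^2 = b2 for the real and
      imaginary part of z. Only differences of the b's enter, so triples that come from no z are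
      covered as well.\<close>
    define u where "u = (b0 - b1 + 1) / 2"
    define v where "v = (b0 - b2 + 1) / 2"
    define \<nu> where "\<nu> = Complex u v"
    obtain h where h: "h > 0" and good: "\<And>G. spectral_proj N G \<Longrightarrow>
        (\<And>x. G x = x \<Longrightarrow> norm (N x - scaleC \<nu> x) \<le> h * norm x) \<Longrightarrow> good G"
      using loc [of \<nu>] by blast
    \<comment> \<open>With tolerance h/4 the real and imaginary parts of the form of N - \<nu> are
      each within h/4, its modulus within h/2, and the numerical radius bound doubles this to
      h.\<close>
    have "good G" if G: "spectral_proj N G" and n0: "near (?K 0) b0 (h / 4) G"
      and n1: "near (?K 1) b1 (h / 4) G" and n2: "near (?K \<i>) b2 (h / 4) G" for G
    proof (rule good [OF G])
      let ?Z = "shift_op N \<nu>"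
      note bG = proj_op_bounded [OF spectral_proj_proj [OF G]]
      have inv: "G (?Z x) = ?Z x" if "G x = x" for x
        using that spectral_proj_commute_N [OF G N, of x]
        by (simp add: shift_op_def bounded_op_diff [OF bG] bounded_op_scaleC [OF bG])
      have rad: "cmod (cinner (?Z x) x) \<le> (h / 2) * (norm x)\<^sup>2" if x: "G x = x" for x
      proof -
        let ?q = "cinner (N x) x" and ?s = "(norm x)\<^sup>2"
        have e1: "(norm (?K 1 x))\<^sup>2 = (norm (N x))\<^sup>2 - 2 * Re ?q + ?s"
          by (simp add: shift_op_def scaleC_one norm_diff_sq)
        have e2: "(norm (?K \<i> x))\<^sup>2 = (norm (N x))\<^sup>2 - 2 * Im ?q + ?s"
          by (simp add: shift_op_def norm_diff_sq cinner_scaleC_right norm_scaleC)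
        have e0: "(norm (?K 0 x))\<^sup>2 = (norm (N x))\<^sup>2" by (simp add: shift_op_def)
        have b: "\<bar>(norm (N x))\<^sup>2 - b0 * ?s\<bar> \<le> h / 4 * ?s"
          "\<bar>(norm (N x))\<^sup>2 - 2 * Re ?q + ?s - b1 * ?s\<bar> \<le> h / 4 * ?s"
          "\<bar>(norm (N x))\<^sup>2 - 2 * Im ?q + ?s - b2 * ?s\<bar> \<le> h / 4 * ?s"
          using nearD [OF n0 x] nearD [OF n1 x] nearD [OF n2 x] unfolding e0 e1 e2 .
        have "2 * (u * ?s) = b0 * ?s - b1 * ?s + ?s" "2 * (v * ?s) = b0 * ?s - b2 * ?s + ?s"
          by (simp_all add: u_def v_def field_simps)
        then have "\<bar>Re ?q - u * ?s\<bar> \<le> h / 4 * ?s" "\<bar>Im ?q - v * ?s\<bar> \<le> h / 4 * ?s"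
          using b by linarith+
        moreover have "Re (cinner (?Z x) x) = Re ?q - u * ?s" "Im (cinner (?Z x) x) = Im ?q - v * ?s"
          by (simp_all add: shift_op_def cinner_diff_left cinner_scaleC_left cinner_self_norm \<nu>_def)
        ultimately show ?thesis
          using cmod_le [of "cinner (?Z x) x"] by simp
      qed
      show "norm (N x - scaleC \<nu> x) \<le> h * norm x" if "G x = x" for x
        using norm_le_of_numerical_radius [OF bounded_op_shift_op [OF N] bG inv rad that]
        by (simp add: shift_op_def)
    qed
    then show ?thesis using h by (intro exI [of _ "h / 4"]) simp
  qed
  \<comment> \<open>The conditions for the shifts \<i>, 1 and 0 are removed in this order, each by
    one bisection with the remaining ones carried along in \<open>Q\<close>.\<close>
  have lev2: "\<exists>h>0. \<forall>G. spectral_proj N G \<longrightarrow> near (?K 0) b0 h G \<and> near (?K 1) b1 h G \<longrightarrow> good G"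
    for b0 b1
    by (rule step [where Q = "\<lambda>h G. near (?K 0) b0 h G \<and> near (?K 1) b1 h G", OF _ _ base])
      (auto intro: near_mono near_comp [OF N])
  have lev1: "\<exists>h>0. \<forall>G. spectral_proj N G \<longrightarrow> near (?K 0) b0 h G \<longrightarrow> good G" for b0
  proof (rule step [where Q = "near (?K 0) b0" and l = 1, OF near_mono])
    show "near (?K 0) b0 h (\<lambda>x. G (F x))"
      if "spectral_proj N G" "spectral_proj N F" "near (?K 0) b0 h G" for G F h
      by (rule near_comp [OF N that])
    show "\<exists>h>0. \<forall>G. spectral_proj N G \<longrightarrow> near (?K 0) b0 h G \<longrightarrow> near (?K 1) b h G \<longrightarrow> good G" for b
      using lev2 [of b0 b] by blast
  qed assumption
  have "\<exists>h>0::real. \<forall>G. spectral_proj N G \<longrightarrow> True \<longrightarrow> good G"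
    by (rule step [where Q = "\<lambda>_ _. True" and l = 0]) (use lev1 in simp_all)
  then show ?thesis using spectral_proj_id by blast
qed

section \<open>From local estimates to normality\<close>

text \<open>\<open>adj T\<close> need not be known to commute with \<open>N\<close>; the commutation
  with \<open>G\<close> is obtained by taking adjoints, as \<open>G\<close> is self-adjoint.\<close>

lemma spectral_proj_commute_adj:
  assumes G: "spectral_proj N G" and T: "bounded_op T" "\<And>x. T (N x) = N (T x)"
  shows "adj T (G x) = G (adj T x)"
proof -
  have sa: "selfadj_op G" using spectral_proj_proj [OF G] by (simp add: proj_op_def)
  show ?thesis
    using adj_commute [OF T(1) selfadj_op_bounded [OF sa] spectral_proj_commute [OF G T]]
    by (simp add: selfadj_op_adj [OF sa])
qed

lemma normal_opI_of_local:
  fixes A :: "'a::complex_hilbert \<Rightarrow> 'a"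
  assumes A: "bounded_op A" and normal: "normal_op (A ^^ n)"
    and loc: "\<And>\<delta> \<nu>. \<delta> > 0 \<Longrightarrow> \<exists>h>0. \<forall>G. spectral_proj (A ^^ n) G \<longrightarrow>
      (\<forall>x. G x = x \<longrightarrow> norm ((A ^^ n) x - scaleC \<nu> x) \<le> h * norm x) \<longrightarrow>
      (\<forall>x. G x = x \<longrightarrow> \<bar>(norm (A x))\<^sup>2 - (norm (adj A x))\<^sup>2\<bar> \<le> \<delta> * (norm x)\<^sup>2)"
  shows "normal_op A"
proof -
  let ?N = "A ^^ n"
  note N = bounded_op_funpow [OF A, of n]
  have AN: "A (?N x) = ?N (A x)" for x by (simp add: funpow_swap1)
  have normal': "?N (adj ?N x) = adj ?N (?N x)" for x
    using normal by (simp add: normal_op_def fun_eq_iff)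
  have small: "\<bar>(norm (A x))\<^sup>2 - (norm (adj A x))\<^sup>2\<bar> \<le> \<delta> * (norm x)\<^sup>2" if "\<delta> > 0" for \<delta> x
  proof -
    define good where "good G \<longleftrightarrow>
      (\<forall>x. G x = x \<longrightarrow> \<bar>(norm (A x))\<^sup>2 - (norm (adj A x))\<^sup>2\<bar> \<le> \<delta> * (norm x)\<^sup>2)" for G
    have "good (\<lambda>x. x)"
    proof (rule spectral_localization [where good = good, OF N normal'])
      show "\<exists>h>0. \<forall>G. spectral_proj ?N G \<longrightarrow>
          (\<forall>x. G x = x \<longrightarrow> norm (?N x - scaleC \<nu> x) \<le> h * norm x) \<longrightarrow> good G" for \<nu>
        unfolding good_def by (rule loc [OF that])
    next
      fix G F
      assume G: "spectral_proj ?N G" and F: "spectral_proj ?N F"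
        and good: "good (\<lambda>x. G (F x))" "good (\<lambda>x. G (x - F x))"
      note pF = spectral_proj_proj [OF F]
      note bG = proj_op_bounded [OF spectral_proj_proj [OF G]]
      note bA' = bounded_op_adj [OF A]
      show "good G"
        unfolding good_def
      proof (intro allI impI)
        fix x assume x: "G x = x"
        let ?y = "F x" and ?z = "x - F x"
        have Fz: "F ?z = 0" by (simp add: bounded_op_diff [OF proj_op_bounded [OF pF]] proj_op_idem [OF pF])
        have Gy: "G (F x) = F x" using spectral_proj_commutes [OF N G F, of x] x by simp
        have y: "G (F ?y) = ?y" by (simp add: proj_op_idem [OF pF] Gy)
        have z: "G (?z - F ?z) = ?z" by (simp add: Fz bounded_op_diff [OF bG] x Gy)
        have "\<bar>(norm (A ?y))\<^sup>2 - (norm (adj A ?y))\<^sup>2\<bar> \<le> \<delta> * (norm ?y)\<^sup>2"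
          "\<bar>(norm (A ?z))\<^sup>2 - (norm (adj A ?z))\<^sup>2\<bar> \<le> \<delta> * (norm ?z)\<^sup>2"
          using good y z unfolding good_def by blast+
        \<comment> \<open>\<open>F\<close> commutes with \<open>A\<close> and \<open>adj A\<close>,
          so both images split orthogonally along \<open>F\<close>, and the bounds on the two pieces
          add up.\<close>
        moreover have "(norm (A x))\<^sup>2 = (norm (A ?y))\<^sup>2 + (norm (A ?z))\<^sup>2"
          using proj_pythagoras [OF pF, of "A x"]
          by (simp add: spectral_proj_commute [OF F A AN] bounded_op_diff [OF A])
        moreover have "(norm (adj A x))\<^sup>2 = (norm (adj A ?y))\<^sup>2 + (norm (adj A ?z))\<^sup>2"
          using proj_pythagoras [OF pF, of "adj A x"]
          by (simp add: spectral_proj_commute_adj [OF F A AN] bounded_op_diff [OF bA'])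
        moreover have "\<delta> * (norm x)\<^sup>2 = \<delta> * (norm ?y)\<^sup>2 + \<delta> * (norm ?z)\<^sup>2"
          using proj_pythagoras [OF pF, of x] by (simp add: distrib_left)
        ultimately show "\<bar>(norm (A x))\<^sup>2 - (norm (adj A x))\<^sup>2\<bar> \<le> \<delta> * (norm x)\<^sup>2" by linarith
      qed
    qed
    then show ?thesis unfolding good_def by blast
  qed
  have "\<bar>(norm (A x))\<^sup>2 - (norm (adj A x))\<^sup>2\<bar> \<le> 0 + e" if "e > 0" for e x
  proof (cases "x = 0")
    case False
    then show ?thesis
      using small [of "e / (norm x)\<^sup>2" x] that by simp
  qed (use that in \<open>simp add: bounded_op_zero [OF A] bounded_op_zero [OF bounded_op_adj [OF A]]\<close>)
  then have eq: "(norm (A x))\<^sup>2 = (norm (adj A x))\<^sup>2" for x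
    using field_le_epsilon [of "\<bar>(norm (A x))\<^sup>2 - (norm (adj A x))\<^sup>2\<bar>" 0] by fastforce
  note A' = bounded_op_adj [OF A]
  let ?Z = "\<lambda>x. A (adj A x) - adj A (A x)"
  have bZ: "bounded_op ?Z"
    by (rule bounded_op_diff_op [OF bounded_op_compose [OF A A'] bounded_op_compose [OF A' A]])
  \<comment> \<open>The self-commutator has zero quadratic form, hence numerical radius 0.\<close>
  have "norm (?Z x) \<le> 2 * 0 * norm x" for x
  proof (rule norm_le_of_numerical_radius [OF bZ bounded_op_id])
    show "cmod (cinner (?Z y) y) \<le> 0 * (norm y)\<^sup>2" for y
      using eq [of y]
      by (simp add: cinner_diff_left cinner_adj_left [OF A] cinner_adj_right [OF A] cinner_self_norm)
  qed simp_all
  then show ?thesis by (simp add: normal_op_def fun_eq_iff)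
qed

section \<open>Paranormal and dominant roots of nearly scalar operators\<close>

lemma norm_funpow_le_on:
  assumes inv: "\<And>x. x \<in> M \<Longrightarrow> S x \<in> M" and le: "\<And>x. x \<in> M \<Longrightarrow> norm (S x) \<le> t * norm x"
    and t: "0 \<le> t" and x: "x \<in> M"
  shows "norm ((S ^^ k) x) \<le> t ^ k * norm (x :: 'a::complex_hilbert)"
proof -
  have "(S ^^ k) x \<in> M \<and> norm ((S ^^ k) x) \<le> t ^ k * norm x"
  proof (induction k)
    case (Suc k)
    have "norm (S ((S ^^ k) x)) \<le> t * norm ((S ^^ k) x)" using Suc.IH by (intro le) simp
    also have "\<dots> \<le> t * (t ^ k * norm x)" using Suc.IH t by (intro mult_left_mono) auto
    finally show ?case using Suc.IH by (simp add: inv mult.assoc)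
  qed (simp add: x)
  then show ?thesis ..
qed

text \<open>On \<open>M\<close> both \<open>A\<close> and \<open>adj A\<close> are squeezed between
  \<open>a / t ^ k\<close> and \<open>t\<close>. The upper bound for \<open>A\<close> comes from the
  growth inequality, and the lower ones by writing the power \<open>Suc k\<close> as k steps, each
  expanding by at most \<open>t\<close>, after a first one.\<close>

lemma paranormal_root_bounds:
  fixes A :: "'a::complex_hilbert \<Rightarrow> 'a"
  assumes A: "bounded_op A"
    and para: "\<And>w. (norm (A w))\<^sup>2 \<le> 1 * norm (A (A w)) * norm w"
    and inv: "\<And>x. x \<in> M \<Longrightarrow> A x \<in> M" and inv': "\<And>x. x \<in> M \<Longrightarrow> adj A x \<in> M"
    and upper: "\<And>x. x \<in> M \<Longrightarrow> norm ((A ^^ Suc k) x) \<le> b * norm x"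
    and lower: "\<And>x. x \<in> M \<Longrightarrow> a * norm x \<le> norm ((A ^^ Suc k) x)"
    and normal: "\<And>x. norm ((adj A ^^ Suc k) x) = norm ((A ^^ Suc k) x)"
    and b: "0 < b" and a: "0 \<le> a" and x: "x \<in> M"
  defines "t \<equiv> root (Suc k) b"
  shows "\<bar>(norm (A x))\<^sup>2 - (norm (adj A x))\<^sup>2\<bar> \<le> (t\<^sup>2 - (a / t ^ k)\<^sup>2) * (norm x)\<^sup>2"
proof -
  have t: "t > 0" "t ^ Suc k = b" unfolding t_def using b by (simp_all del: power_Suc)
  have leA: "norm (A y) \<le> t * norm y" if "y \<in> M" for y
  proof -
    have "norm (A y) ^ Suc k \<le> norm ((A ^^ Suc k) y) * norm y ^ k"
      using norm_power_le_of_growth [OF para, of y k] by simp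
    also have "\<dots> \<le> (b * norm y) * norm y ^ k"
      by (rule mult_right_mono [OF upper [OF that]]) simp
    also have "\<dots> = (t * norm y) ^ Suc k"
      by (simp only: power_mult_distrib t(2)) simp
    finally show ?thesis by (rule power_le_imp_le_base) (use t(1) in simp)
  qed
  \<comment> \<open>Paranormality need not pass to the adjoint, so this bound is obtained by duality
    inside \<open>M\<close>; normality of the power supplies the lower bound for
    \<open>adj A\<close>.\<close>
  have leA': "norm (adj A y) \<le> t * norm y" if "y \<in> M" for y
  proof (cases "adj A y = 0")
    case False
    have "(norm (adj A y))\<^sup>2 = Re (cinner y (A (adj A y)))"
      by (simp flip: Re_cinner_self cinner_adj_left [OF A])
    also have "\<dots> \<le> norm y * norm (A (adj A y))" by (rule Re_cinner_le)
    also have "\<dots> \<le> norm y * (t * norm (adj A y))"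
      by (intro mult_left_mono leA inv' that) simp
    finally show ?thesis using False by (simp add: power2_eq_square mult_ac)
  qed (use t(1) in simp)
  have ge: "(a / t ^ k) * norm x \<le> norm (S x)"
    if S: "\<And>y. y \<in> M \<Longrightarrow> S y \<in> M" "\<And>y. y \<in> M \<Longrightarrow> norm (S y) \<le> t * norm y"
      and eq: "norm ((S ^^ Suc k) x) = norm ((A ^^ Suc k) x)" for S :: "'a \<Rightarrow> 'a"
  proof -
    have "a * norm x \<le> norm ((S ^^ Suc k) x)" unfolding eq by (rule lower [OF x])
    also have "\<dots> = norm ((S ^^ k) (S x))" by (simp add: funpow_swap1)
    also have "\<dots> \<le> t ^ k * norm (S x)"
      using t(1) by (intro norm_funpow_le_on [where M = M] S x) auto
    finally show ?thesis using t(1) by (simp add: field_simps)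
  qed
  have sq: "(a / t ^ k)\<^sup>2 * (norm x)\<^sup>2 \<le> (norm y)\<^sup>2 \<and> (norm y)\<^sup>2 \<le> t\<^sup>2 * (norm x)\<^sup>2"
    if "(a / t ^ k) * norm x \<le> norm y" "norm y \<le> t * norm x" for y :: 'a
  proof -
    have "0 \<le> (a / t ^ k) * norm x" using a t(1) by simp
    from power_mono [OF that(1) this, where n = 2] power_mono [OF that(2), where n = 2]
    show ?thesis by (simp only: power_mult_distrib norm_ge_zero)
  qed
  show ?thesis
    using sq [OF ge [OF inv leA refl] leA [OF x]] sq [OF ge [OF inv' leA' normal] leA' [OF x]]
    by (simp add: left_diff_distrib abs_le_iff)
qed

text \<open>At h = 0 the gap vanishes, since a / r^k = r for r the root of order k + 1 of
  \<open>a\<close>; the rest is continuity from the right.\<close>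

lemma root_gap_small:
  assumes a: "a > 0" and \<delta>: "\<delta> > 0"
  shows "\<exists>h>0. h < a \<and> (root (Suc k) (a + h))\<^sup>2 - ((a - h) / root (Suc k) (a + h) ^ k)\<^sup>2 < \<delta>"
proof -
  let ?r = "root (Suc k) a"
  let ?\<phi> = "\<lambda>h. (root (Suc k) (a + h))\<^sup>2 - ((a - h) / root (Suc k) (a + h) ^ k)\<^sup>2"
  have r: "?r > 0" "?r ^ Suc k = a" using a by (simp_all del: power_Suc)
  have "(?\<phi> \<longlongrightarrow> (root (Suc k) (a + 0))\<^sup>2 - ((a - 0) / root (Suc k) (a + 0) ^ k)\<^sup>2) (at_right 0)"
    using r(1) by (intro tendsto_intros) auto
  moreover have "a / ?r ^ k = ?r" using r by (simp add: field_simps)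
  ultimately have "(?\<phi> \<longlongrightarrow> 0) (at_right 0)" by simp
  then have "\<forall>\<^sub>F h in at_right 0. ?\<phi> h < \<delta>" using \<delta> by (rule order_tendstoD(2))
  moreover have "\<forall>\<^sub>F h in at_right 0. 0 < h \<and> h < a"
    using a by (auto simp: eventually_at_right_field)
  ultimately have "\<forall>\<^sub>F h in at_right 0. 0 < h \<and> h < a \<and> ?\<phi> h < \<delta>"
    by eventually_elim simp
  then show ?thesis
    using eventually_happens [of _ "at_right (0::real)"] trivial_limit_at_right_real by fastforce
qed

lemma paranormal_local:
  fixes A :: "'a::complex_hilbert \<Rightarrow> 'a"
  assumes A: "bounded_op A"
    and para: "\<And>w. (norm (A w))\<^sup>2 \<le> 1 * norm (A (A w)) * norm w"
    and n: "n > 0" and normal: "normal_op (A ^^ n)" and \<delta>: "\<delta> > 0"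
  shows "\<exists>h>0. \<forall>G. spectral_proj (A ^^ n) G \<longrightarrow>
      (\<forall>x. G x = x \<longrightarrow> norm ((A ^^ n) x - scaleC \<nu> x) \<le> h * norm x) \<longrightarrow>
      (\<forall>x. G x = x \<longrightarrow> \<bar>(norm (A x))\<^sup>2 - (norm (adj A x))\<^sup>2\<bar> \<le> \<delta> * (norm x)\<^sup>2)"
proof -
  obtain k where k: "n = Suc k" using n gr0_implies_Suc by blast
  let ?N = "A ^^ n"
  note N = bounded_op_funpow [OF A, of n]
  have AN: "A (?N x) = ?N (A x)" for x by (simp add: funpow_swap1)
  have normal': "norm ((adj A ^^ Suc k) x) = norm ((A ^^ Suc k) x)" for x
    using normal_norm_adj [OF N, of x] normal
    by (simp add: normal_op_def fun_eq_iff adj_funpow [OF A] k del: funpow.simps)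
  define c where "c = cmod \<nu>"
  \<comment> \<open>On a piece, |N x| lies between (c - h) |x| and (c + h) |x|. For \<nu> = 0 the
    lower bound 0 suffices, and \<open>h = sqrt \<delta> ^ Suc k\<close> makes the squared root
    equal \<delta>; otherwise \<open>a = c - h\<close>.\<close>
  have "\<exists>h>0. \<exists>a\<ge>0. a \<le> max 0 (c - h) \<and>
      (root (Suc k) (c + h))\<^sup>2 - (a / root (Suc k) (c + h) ^ k)\<^sup>2 \<le> \<delta>"
  proof (cases "\<nu> = 0")
    case True
    have "(root (Suc k) (sqrt \<delta> ^ Suc k))\<^sup>2 = \<delta>"
      using \<delta> by (subst real_root_power_cancel) auto
    then show ?thesis
      using \<delta> True by (intro exI [of _ "sqrt \<delta> ^ Suc k"] conjI exI [of _ 0])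
        (auto simp: c_def simp del: power_Suc)
  next
    case False
    then have "c > 0" by (simp add: c_def)
    from root_gap_small [OF this \<delta>, of k] obtain h where "h > 0" "h < c"
      "(root (Suc k) (c + h))\<^sup>2 - ((c - h) / root (Suc k) (c + h) ^ k)\<^sup>2 < \<delta>"
      by blast
    then show ?thesis by (intro exI [of _ h] conjI exI [of _ "c - h"]) auto
  qed
  then obtain h a where h: "h > 0" and a: "a \<ge> 0" "a \<le> max 0 (c - h)"
    and gap: "(root (Suc k) (c + h))\<^sup>2 - (a / root (Suc k) (c + h) ^ k)\<^sup>2 \<le> \<delta>"
    by blast
  have "\<bar>(norm (A x))\<^sup>2 - (norm (adj A x))\<^sup>2\<bar> \<le> \<delta> * (norm x)\<^sup>2"
    if G: "spectral_proj ?N G"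
      and close: "\<And>x. G x = x \<Longrightarrow> norm (?N x - scaleC \<nu> x) \<le> h * norm x" and x: "G x = x" for G x
  proof -
    let ?M = "{x. G x = x}"
    have "\<bar>(norm (A x))\<^sup>2 - (norm (adj A x))\<^sup>2\<bar>
        \<le> ((root (Suc k) (c + h))\<^sup>2 - (a / root (Suc k) (c + h) ^ k)\<^sup>2) * (norm x)\<^sup>2"
    proof (rule paranormal_root_bounds [where M = ?M, OF A para])
      show "A y \<in> ?M" if "y \<in> ?M" for y
        using spectral_proj_commute [OF G A AN, of y] that by simp
      show "adj A y \<in> ?M" if "y \<in> ?M" for y
        using spectral_proj_commute_adj [OF G A AN, of y] that by simp
      show "norm ((A ^^ Suc k) y) \<le> (c + h) * norm y" if "y \<in> ?M" for y
        using close [of y] norm_triangle_sub [of "?N y" "scaleC \<nu> y"] that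
        unfolding k [symmetric] by (simp add: norm_scaleC c_def distrib_right)
      show "a * norm y \<le> norm ((A ^^ Suc k) y)" if "y \<in> ?M" for y
      proof -
        have "c * norm y - h * norm y \<le> norm (?N y)"
          using close [of y] norm_triangle_sub [of "scaleC \<nu> y" "?N y"] that
          by (simp add: norm_scaleC c_def norm_minus_commute)
        moreover have "a * norm y \<le> max 0 (c - h) * norm y"
          using a(2) by (rule mult_right_mono) simp
        moreover have "max 0 (c - h) * norm y = max 0 (c * norm y - h * norm y)"
          by (simp add: max_def left_diff_distrib mult_le_cancel_right)
        ultimately have "a * norm y \<le> max 0 (norm (?N y))" by linarith
        then show ?thesis by (simp add: k)
      qed
      show "0 < c + h" using h by (simp add: c_def add_nonneg_pos)
    qed (use normal' a x in auto)
    also have "\<dots> \<le> \<delta> * (norm x)\<^sup>2" using gap by (rule mult_right_mono) simp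
    finally show ?thesis .
  qed
  then show ?thesis using h by blast
qed

section \<open>Interpolation at the roots, and the dominant case\<close>

text \<open>The roots are \<open>l0 * w ^ j\<close> with \<open>w\<close> a primitive n-th root of
  unity, so the sums are geometric. They say that the interpolation weights reproduce
  \<open>x\<close> and cancel the higher powers of \<open>A\<close>.\<close>

lemma complex_roots_average:
  assumes n: "n > 0" and \<nu>: "\<nu> \<noteq> (0::complex)"
  obtains r :: "nat \<Rightarrow> complex" where "\<And>j. r j ^ n = \<nu>" "\<And>j. r j \<noteq> 0"
    "\<And>k. k < n \<Longrightarrow> (\<Sum>j<n. inverse (r j) ^ k) = (if k = 0 then of_nat n else 0)"
proof -
  define l0 where "l0 = exp (Ln \<nu> / of_nat n)"
  define w where "w = exp (2 * of_real pi * \<i> * of_nat 1 / of_nat n)"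
  have l0: "l0 ^ n = \<nu>" "l0 \<noteq> 0" using n \<nu> by (simp_all add: l0_def exp_divide_power_eq)
  have w: "w ^ n = 1" "w \<noteq> 0" using n by (simp_all only: w_def complex_root_unity exp_not_eq_zero) auto
  have w_pow: "w ^ k = exp (2 * of_real pi * \<i> * of_nat k / of_nat n)" for k
    by (simp add: w_def mult_ac flip: exp_of_nat_mult)
  have prim: "w ^ k \<noteq> 1" if "0 < k" "k < n" for k
    using complex_root_unity_eq [of n k 0] n that unfolding w_pow by simp
  show thesis
  proof
    fix j
    show "(l0 * w ^ j) ^ n = \<nu>"
      by (simp add: power_mult_distrib l0 w flip: power_mult) (simp add: power_mult w mult.commute [of j])
    show "l0 * w ^ j \<noteq> 0" by (simp add: l0 w)
  next
    fix k assume "k < n"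
    show "(\<Sum>j<n. inverse (l0 * w ^ j) ^ k) = (if k = 0 then of_nat n else 0)"
    proof (cases "k = 0")
      case False
      define z where "z = inverse (w ^ k)"
      have "z \<noteq> 1" using prim [of k] False \<open>k < n\<close> by (auto simp: z_def inverse_eq_1_iff)
      have "z ^ n = inverse ((w ^ n) ^ k)"
        by (simp only: z_def power_inverse power_mult [symmetric] mult.commute)
      then have "z ^ n = 1" by (simp add: w)
      have "inverse (l0 * w ^ j) ^ k = inverse l0 ^ k * z ^ j" for j
        by (simp add: z_def power_mult_distrib power_inverse mult.commute [of j] flip: power_mult)
      then have "(\<Sum>j<n. inverse (l0 * w ^ j) ^ k) = inverse l0 ^ k * (\<Sum>j<n. z ^ j)"
        by (simp only: sum_distrib_left)
      also have "(\<Sum>j<n. z ^ j) = 0"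
        using \<open>z \<noteq> 1\<close> \<open>z ^ n = 1\<close> by (simp add: geometric_sum)
      finally show ?thesis using False by simp
    qed simp
  qed
qed

text \<open>Lagrange interpolation at the roots \<open>r j\<close> of \<open>\<nu>\<close>: \<open>x\<close> is the sum of the vectors
  \<open>(1/n) \<Sum>k<n. (r j)\<^sup>-\<^sup>k A\<^sup>k x\<close>, each of which is almost an eigenvector for \<open>r j\<close>.\<close>

lemma approximate_eigenvector_decomposition:
  fixes A :: "'a::complex_hilbert \<Rightarrow> 'a"
  assumes A: "bounded_op A" and n: "n > 0" and \<nu>: "\<nu> \<noteq> 0"
  obtains r :: "nat \<Rightarrow> complex" and y :: "nat \<Rightarrow> 'a \<Rightarrow> 'a" where
    "\<And>x. (\<Sum>j<n. y j x) = x"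
    "\<And>j x. norm (shift_op A (r j) (y j x))
      \<le> cmod (r j) / cmod \<nu> * norm ((A ^^ n) x - scaleC \<nu> x)"
proof -
  obtain r :: "nat \<Rightarrow> complex" where r: "\<And>j. r j ^ n = \<nu>" "\<And>j. r j \<noteq> 0"
    and avg: "\<And>k. k < n \<Longrightarrow> (\<Sum>j<n. inverse (r j) ^ k) = (if k = 0 then of_nat n else 0)"
    using complex_roots_average [OF n \<nu>] by blast
  define y where "y j x = (\<Sum>k<n. scaleC (inverse (r j) ^ k / of_nat n) ((A ^^ k) x))" for j x
  show thesis
  proof
    fix x
    have "(\<Sum>j<n. y j x) = (\<Sum>k<n. \<Sum>j<n. scaleC (inverse (r j) ^ k / of_nat n) ((A ^^ k) x))"
      unfolding y_def by (rule sum.swap)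
    also have "\<dots> = (\<Sum>k<n. if k = 0 then x else 0)"
    proof (rule sum.cong [OF refl])
      fix k assume "k \<in> {..<n}"
      have "(\<Sum>j<n. scaleC (inverse (r j) ^ k / of_nat n) ((A ^^ k) x))
          = scaleC ((\<Sum>j<n. inverse (r j) ^ k) / of_nat n) ((A ^^ k) x)"
        by (simp only: scaleC_sum_left sum_divide_distrib)
      also have "\<dots> = (if k = 0 then x else 0)"
        using avg [of k] \<open>k \<in> {..<n}\<close> n by (simp add: scaleC_one)
      finally show "(\<Sum>j<n. scaleC (inverse (r j) ^ k / of_nat n) ((A ^^ k) x))
          = (if k = 0 then x else 0)" .
    qed
    also have "\<dots> = x" using n by simp
    finally show "(\<Sum>j<n. y j x) = x" .
  next
    fix j x
    \<comment> \<open>Applying A - r_j raises the power of \<open>A\<close> by one and turns the sum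
      into a telescoping one; the ends combine to A^n x - \<nu> x because r_j^n = \<nu>.\<close>
    define a where "a k = scaleC (r j * inverse (r j) ^ k / of_nat n) ((A ^^ k) x)" for k
    have "shift_op A (r j) (y j x) = (\<Sum>k<n. a (Suc k) - a k)"
      using r(2) [of j]
      by (simp add: shift_op_def y_def a_def bounded_op_sum [OF A] bounded_op_scaleC [OF A]
          scaleC_sum_right scaleC_scaleC sum_subtractf mult.assoc [symmetric])
    also have "\<dots> = a n - a 0" by (rule sum_lessThan_telescope)
    also have "\<dots> = scaleC (r j / (\<nu> * of_nat n)) ((A ^^ n) x - scaleC \<nu> x)"
      using \<nu> by (simp add: a_def power_inverse r(1) scaleC_diff_right scaleC_scaleC field_simps)
    finally have "norm (shift_op A (r j) (y j x))
        = cmod (r j) / cmod \<nu> * norm ((A ^^ n) x - scaleC \<nu> x) / real n"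
      by (simp add: norm_scaleC norm_divide norm_mult)
    also have "\<dots> \<le> cmod (r j) / cmod \<nu> * norm ((A ^^ n) x - scaleC \<nu> x) / 1"
      using n by (intro divide_left_mono) auto
    finally show "norm (shift_op A (r j) (y j x))
        \<le> cmod (r j) / cmod \<nu> * norm ((A ^^ n) x - scaleC \<nu> x)" by simp
  qed
qed

text \<open>Scalars commute with everything, so the self-commutator may be computed at whichever
  shift makes the vector almost an eigenvector.\<close>

lemma self_commutator_shift:
  assumes A: "bounded_op A"
  shows "adj A (A x) - A (adj A x)
    = adj (shift_op A l) (shift_op A l x) - shift_op A l (adj (shift_op A l) x)"
  unfolding adj_shift_op [OF A]
  by (simp add: shift_op_def bounded_op_diff [OF A] bounded_op_scaleC [OF A]
      bounded_op_diff [OF bounded_op_adj [OF A]] bounded_op_scaleC [OF bounded_op_adj [OF A]]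
      scaleC_diff_right scaleC_commute [of l])

text \<open>Stated for single vectors, hence uniform in the projection. For \<nu> = 0 the roots
  coalesce and interpolation breaks down; there the growth inequality with the dominance constant at
  0 bounds |A x| directly.\<close>

lemma dominant_local:
  fixes A :: "'a::complex_hilbert \<Rightarrow> 'a"
  assumes A: "bounded_op A" and dom: "dominant A" and n: "n > 0" and \<delta>: "\<delta> > 0"
  shows "\<exists>h>0. \<forall>x. norm ((A ^^ n) x - scaleC \<nu> x) \<le> h * norm x \<longrightarrow>
      \<bar>(norm (A x))\<^sup>2 - (norm (adj A x))\<^sup>2\<bar> \<le> \<delta> * (norm x)\<^sup>2"
proof (cases "\<nu> = 0")
  case True
  have "shift_op A 0 = A" by (simp add: shift_op_def)
  then obtain m where m: "m > 0" and adj_le: "\<And>x. norm (adj A x) \<le> m * norm (A x)"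
    using dom unfolding dominant_def by metis
  have growth: "(norm (A w))\<^sup>2 \<le> m * norm (A (A w)) * norm w" for w
  proof -
    have "(norm (A w))\<^sup>2 \<le> norm (adj A (A w)) * norm w"
      unfolding norm_sq_adj_self [OF A] by (rule Re_cinner_le)
    also have "\<dots> \<le> m * norm (A (A w)) * norm w" by (rule mult_right_mono [OF adj_le]) simp
    finally show ?thesis .
  qed
  obtain k where k: "n = Suc k" using n gr0_implies_Suc by blast
  define C where "C = m ^ (\<Sum>i\<le>k. i)"
  \<comment> \<open>Chosen so that |A x| \<le> e |x| makes (1 + m^2) |A x|^2 at most \<delta> |x|^2;
    \<open>h\<close> is then the closeness that forces |A x| \<le> e |x|.\<close>
  define e where "e = sqrt (\<delta> / (1 + m\<^sup>2))"
  define h where "h = e ^ n / C"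
  have C: "C > 0" using m by (simp add: C_def)
  have e: "e > 0" using \<delta> by (simp add: e_def add_pos_nonneg)
  have e2: "(1 + m\<^sup>2) * e\<^sup>2 = \<delta>"
    using \<delta> zero_le_power2 [of m] by (simp add: e_def add_nonneg_eq_0_iff)
  have h: "h > 0" using C e by (simp add: h_def)
  have "\<bar>(norm (A x))\<^sup>2 - (norm (adj A x))\<^sup>2\<bar> \<le> \<delta> * (norm x)\<^sup>2"
    if x: "norm ((A ^^ n) x - scaleC \<nu> x) \<le> h * norm x" for x
  proof -
    have "norm (A x) ^ n \<le> C * norm ((A ^^ n) x) * norm x ^ k"
      unfolding C_def k by (rule norm_power_le_of_growth [OF growth]) (use m in simp)
    also have "\<dots> \<le> C * (h * norm x) * norm x ^ k"
      using x True C by (intro mult_right_mono mult_left_mono) auto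
    also have "\<dots> = (e * norm x) ^ n"
      using C by (simp add: h_def power_mult_distrib k)
    finally have "norm (A x) \<le> e * norm x"
      using e n by (subst (asm) power_mono_iff) auto
    from power_mono [OF this, where n = 2] have a: "(norm (A x))\<^sup>2 \<le> e\<^sup>2 * (norm x)\<^sup>2"
      by (simp add: power_mult_distrib)
    from power_mono [OF adj_le [of x], where n = 2] have "(norm (adj A x))\<^sup>2 \<le> m\<^sup>2 * (norm (A x))\<^sup>2"
      by (simp add: power_mult_distrib)
    then have "\<bar>(norm (A x))\<^sup>2 - (norm (adj A x))\<^sup>2\<bar> \<le> (1 + m\<^sup>2) * (norm (A x))\<^sup>2"
      using zero_le_power2 [of "norm (A x)"] zero_le_power2 [of "norm (adj A x)"]
      by (simp only: distrib_right)
    also have "\<dots> \<le> (1 + m\<^sup>2) * (e\<^sup>2 * (norm x)\<^sup>2)"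
      by (rule mult_left_mono [OF a]) simp
    finally show ?thesis by (simp only: mult.assoc [symmetric] e2)
  qed
  with h show ?thesis by blast
next
  case False
  obtain r :: "nat \<Rightarrow> complex" and y :: "nat \<Rightarrow> 'a \<Rightarrow> 'a" where sum_y: "\<And>x. (\<Sum>j<n. y j x) = x"
    and eig: "\<And>j x. norm (shift_op A (r j) (y j x))
      \<le> cmod (r j) / cmod \<nu> * norm ((A ^^ n) x - scaleC \<nu> x)"
    by (rule approximate_eigenvector_decomposition [OF A n False]) (rule that)
  let ?B = "\<lambda>j. shift_op A (r j)"
  have "\<forall>j. \<exists>m>0. \<forall>x. norm (adj (?B j) x) \<le> m * norm (?B j x)"
    using dom unfolding dominant_def by blast
  then obtain m where m: "\<And>j. m j > 0" and adj_le: "\<And>j x. norm (adj (?B j) x) \<le> m j * norm (?B j x)"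
    by metis
  have "\<forall>j. \<exists>L>0. \<forall>x. norm (?B j x) \<le> L * norm x"
    using bounded_op_bound [OF bounded_op_shift_op [OF A]] by blast
  then obtain L where L: "\<And>j. L j > 0" and B_le: "\<And>j x. norm (?B j x) \<le> L j * norm x"
    by metis
  let ?D = "\<lambda>x. adj A (A x) - A (adj A x)"
  have D: "bounded_op ?D"
    by (rule bounded_op_diff_op [OF bounded_op_compose [OF bounded_op_adj [OF A] A]
          bounded_op_compose [OF A bounded_op_adj [OF A]]])
  \<comment> \<open>With B = A - r_j, both \<open>adj B (B y)\<close> and \<open>B (adj B y)\<close>
    are controlled by |B y|, with factors L and L m; the last factor is the eigenvector
    error.\<close>
  define c where "c j = L j * (1 + m j) * (cmod (r j) / cmod \<nu>)" for j
  define s where "s = (\<Sum>j<n. c j)"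
  have c: "c j \<ge> 0" for j using L [of j] m [of j] by (simp add: c_def)
  have s: "s \<ge> 0" unfolding s_def by (intro sum_nonneg c)
  have D_le: "norm (?D (y j x)) \<le> c j * norm ((A ^^ n) x - scaleC \<nu> x)" for j x
  proof -
    let ?z = "?B j (y j x)"
    have 1: "norm (adj (?B j) ?z) \<le> L j * norm ?z"
      by (rule norm_adj_le [OF bounded_op_shift_op [OF A] B_le])
    have "norm (?B j (adj (?B j) (y j x))) \<le> L j * norm (adj (?B j) (y j x))" by (rule B_le)
    also have "\<dots> \<le> L j * (m j * norm ?z)" using L [of j] by (intro mult_left_mono adj_le) simp
    finally have "norm (?D (y j x)) \<le> L j * norm ?z + L j * (m j * norm ?z)"
      using 1 norm_triangle_ineq4 [of "adj (?B j) ?z" "?B j (adj (?B j) (y j x))"]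
      unfolding self_commutator_shift [OF A, of _ "r j"] by linarith
    also have "\<dots> = L j * (1 + m j) * norm ?z" by (simp add: algebra_simps)
    also have "\<dots> \<le> L j * (1 + m j) * (cmod (r j) / cmod \<nu> * norm ((A ^^ n) x - scaleC \<nu> x))"
      using L [of j] m [of j] by (intro mult_left_mono eig) auto
    finally show ?thesis by (simp add: c_def mult.assoc)
  qed
  \<comment> \<open>The summand 1 avoids division by zero and still leaves \<open>s * h\<close> at
    most \<delta>.\<close>
  define h where "h = \<delta> / (s + 1)"
  have h: "h > 0" using s \<delta> by (simp add: h_def)
  have "\<bar>(norm (A x))\<^sup>2 - (norm (adj A x))\<^sup>2\<bar> \<le> \<delta> * (norm x)\<^sup>2"
    if x: "norm ((A ^^ n) x - scaleC \<nu> x) \<le> h * norm x" for x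
  proof -
    have "norm (?D x) = norm (?D (\<Sum>j<n. y j x))" by (simp only: sum_y)
    also have "\<dots> = norm (\<Sum>j<n. ?D (y j x))" by (simp only: bounded_op_sum [OF D])
    also have "\<dots> \<le> (\<Sum>j<n. c j * norm ((A ^^ n) x - scaleC \<nu> x))"
      by (intro order_trans [OF norm_sum] sum_mono D_le)
    also have "\<dots> = s * norm ((A ^^ n) x - scaleC \<nu> x)" by (simp only: s_def sum_distrib_right)
    also have "\<dots> \<le> s * (h * norm x)" by (rule mult_left_mono [OF x s])
    also have "\<dots> = (s * h) * norm x" by simp
    also have "\<dots> \<le> \<delta> * norm x"
      using s \<delta> by (intro mult_right_mono) (simp_all add: h_def field_simps)
    finally have "norm (?D x) \<le> \<delta> * norm x" .
    have "\<bar>(norm (A x))\<^sup>2 - (norm (adj A x))\<^sup>2\<bar> = \<bar>Re (cinner (?D x) x)\<bar>"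
      by (simp add: cinner_diff_left cinner_adj_left [OF A, of "A x"]
          cinner_adj_right [OF A, of "adj A x"] Re_cinner_self)
    also have "\<dots> \<le> norm (?D x) * norm x"
      using abs_Re_le_cmod Cauchy_Schwarz_cinner order_trans by blast
    also have "\<dots> \<le> \<delta> * norm x * norm x"
      by (rule mult_right_mono [OF \<open>norm (?D x) \<le> \<delta> * norm x\<close>]) simp
    finally show ?thesis by (simp add: power2_eq_square mult.assoc)
  qed
  with h show ?thesis by blast
qed

theorem theorem3p9:
  fixes A :: "'a::complex_hilbert \<Rightarrow> 'a" and n :: nat
  assumes "infinite_dim TYPE('a)"
    and "n > 1"
    and "bounded_op A"
    and "normal_op (A ^^ n)"
    and "dominant A \<or> class_A11 A"
  shows "normal_op A"
proof (rule normal_opI_of_local [OF assms(3,4)])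
  fix \<delta> :: real and \<nu> :: complex
  assume \<delta>: "\<delta> > 0"
  have n: "n > 0" using \<open>n > 1\<close> by simp
  from \<open>dominant A \<or> class_A11 A\<close>
  show "\<exists>h>0. \<forall>G. spectral_proj (A ^^ n) G \<longrightarrow>
      (\<forall>x. G x = x \<longrightarrow> norm ((A ^^ n) x - scaleC \<nu> x) \<le> h * norm x) \<longrightarrow>
      (\<forall>x. G x = x \<longrightarrow> \<bar>(norm (A x))\<^sup>2 - (norm (adj A x))\<^sup>2\<bar> \<le> \<delta> * (norm x)\<^sup>2)"
  proof
    assume "dominant A"
    then show ?thesis using dominant_local [OF assms(3) _ n \<delta>] by blast
  next
    assume A11: "class_A11 A"
    show ?thesis
    proof (rule paranormal_local [OF assms(3) _ n assms(4) \<delta>])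
      show "(norm (A w))\<^sup>2 \<le> 1 * norm (A (A w)) * norm w" for w
        using class_A11_paranormal [OF assms(3) A11] by simp
    qed
  qed
qed

end
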